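(* Let $c_0,c_1,c_2,\dots$ be formal (infinitesimal) variables and let $P(X)=\sum_{a\ge 0}c_aX^a$. Put $A(v,y)=v^{-1}P\bigl(v(1+y)^2\bigr)$ and define $$T(v,y)\;=\;y+\sum_{r=1}^\infty\frac1{r!}\Bigl(\frac1y\frac{d}{dy}\Bigr)^{r-1}\Bigl(\frac{1+y}{y}\,A(v,y)^r\Bigr)\;\in\;\mathbb{Q}[v^{\pm1},y^{\pm1}][[c_0,c_1,\dots]].$$ Then for every positive even integer $N$, $$\bigl[v^{N-1}y^{-2}\bigr]\biggl(\frac{T(v,y)-T(v,-y)}{2}\biggr)^{-N}\;=\;-\,\frac{(2N+1)!}{(N-1)!\,(N+1)!}\,c_N .$$
   Context: $[v^{m}y^{k}]F$ denotes the coefficient of $v^my^k$ in $F$; these coefficients are formal power series in the $c_a$. Since $\frac{T(v,y)-T(v,-y)}{2}=y\,(1+\varepsilon)$ with $\varepsilon$ in the ideal generated by the $c_a$, its $(-N)$-th power is defined as $y^{-N}(1+\varepsilon)^{-N}$ expanded as a power series in the $c_a$. The operator $\frac1y\frac{d}{dy}$ acts coefficientwise on Laurent polynomials in $y$. The statement also holds with $P$ a polynomial (only finitely many $c_a$ nonzero). *)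

theory Defs
  imports Complex_Main "HOL-Library.Poly_Mapping" "HOL-Library.Product_Plus"
begin

text \<open>Laurent polynomials in v, y over the rationals: the key (i,j) stands for v^i y^j.
  Formal power series in the variables c_0, c_1, ... with Laurent-polynomial coefficients:
  a function from c-monomials (finitely supported exponent vectors) to Laurent polynomials.\<close>

type_synonym laur = "(int \<times> int) \<Rightarrow>\<^sub>0 rat"
type_synonym ser = "(nat \<Rightarrow>\<^sub>0 nat) \<Rightarrow> laur"

definition mon :: "int \<Rightarrow> int \<Rightarrow> laur" where
  "mon i j = Poly_Mapping.single (i, j) 1"

definition lconst :: "rat \<Rightarrow> laur" where
  "lconst c = Poly_Mapping.single (0, 0) c"

text \<open>The operator (1/y) d/dy on Laurent polynomials.\<close>
definition dyL :: "laur \<Rightarrow> laur" where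
  "dyL p = (\<Sum>ij\<in>Poly_Mapping.keys p. Poly_Mapping.single (fst ij, snd ij - 2) (of_int (snd ij) * Poly_Mapping.lookup p ij))"

text \<open>Substitution y := -y.\<close>
definition flipL :: "laur \<Rightarrow> laur" where
  "flipL p = (\<Sum>ij\<in>Poly_Mapping.keys p. Poly_Mapping.single ij
               ((if even (snd ij) then 1 else -1) * Poly_Mapping.lookup p ij))"

definition sconst :: "laur \<Rightarrow> ser" where
  "sconst p = (\<lambda>m. if m = 0 then p else 0)"

definition cvar :: "nat \<Rightarrow> ser" where
  "cvar a = (\<lambda>m. if m = Poly_Mapping.single a 1 then 1 else 0)"

definition sadd :: "ser \<Rightarrow> ser \<Rightarrow> ser" where
  "sadd f g = (\<lambda>m. f m + g m)"

definition ssub :: "ser \<Rightarrow> ser \<Rightarrow> ser" where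
  "ssub f g = (\<lambda>m. f m - g m)"

definition sscale :: "laur \<Rightarrow> ser \<Rightarrow> ser" where
  "sscale c f = (\<lambda>m. c * f m)"

definition smul :: "ser \<Rightarrow> ser \<Rightarrow> ser" where
  "smul f g = (\<lambda>m. \<Sum>p\<in>{p. fst p + snd p = m}. f (fst p) * g (snd p))"

primrec spow :: "ser \<Rightarrow> nat \<Rightarrow> ser" where
  "spow f 0 = sconst 1"
| "spow f (Suc k) = smul f (spow f k)"

text \<open>Sum of a locally finite family of series (for every c-monomial only finitely many members
  have a nonzero coefficient there); all families used below are locally finite because the
  k-th member has c-adic order at least k (or, for A, is a multiple of a single variable c_a).\<close>
definition ssum :: "(nat \<Rightarrow> ser) \<Rightarrow> ser" where
  "ssum F = (\<lambda>m. \<Sum>k\<in>{k. F k m \<noteq> 0}. F k m)"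

definition dyS :: "ser \<Rightarrow> ser" where
  "dyS f = (\<lambda>m. dyL (f m))"

definition flipS :: "ser \<Rightarrow> ser" where
  "flipS f = (\<lambda>m. flipL (f m))"

text \<open>A(v,y) = v^{-1} P(v(1+y)^2) = sum_a c_a v^(a-1) (1+y)^(2a).\<close>
definition Aser :: ser where
  "Aser = ssum (\<lambda>a. sscale (mon (int a - 1) 0 * (1 + mon 0 1) ^ (2 * a)) (cvar a))"

definition Tser :: ser where
  "Tser = sadd (sconst (mon 0 1))
     (ssum (\<lambda>r. if r = 0 then (\<lambda>_. 0)
                 else sscale (lconst (1 / fact r))
                        ((dyS ^^ (r - 1)) (smul (sconst (mon 0 (-1) + 1)) (spow Aser r)))))"

definition Sser :: ser where
  "Sser = sscale (lconst (1/2)) (ssub Tser (flipS Tser))"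

definition epsser :: ser where
  "epsser = ssub (smul (sconst (mon 0 (-1))) Sser) (sconst 1)"

text \<open>S^(-N) = y^(-N) (1+eps)^(-N) = y^(-N) sum_k binom(-N,k) eps^k.\<close>
definition Sinvpow :: "nat \<Rightarrow> ser" where
  "Sinvpow N = sscale (mon 0 (- int N))
     (ssum (\<lambda>k. sscale (lconst ((- of_nat N :: rat) gchoose k)) (spow epsser k)))"

end

theory Submission
  imports Defs
begin

text \<open>
  By Lagrange inversion, \<open>T = Y + A(Y)\<close> where \<open>Y = y + O(c)\<close> solves \<open>Y^2 = y^2 + 2 A(Y)\<close>.  Let
  \<open>P = 1 + Y(y)\<close> and \<open>M = 1 + Y(-y)\<close>.  Then \<open>s = v P^2\<close> and \<open>t = v M^2\<close> satisfy
  \<open>\<phi>(s) - 2 v P = v (y^2 - 1) = \<phi>(t) - 2 v M\<close> with \<open>\<phi>(X) = X - 2 \<Sum> c_a X^a\<close>, and the series to be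
  raised to the power \<open>-N\<close> is \<open>q / (4 v)\<close> for \<open>q = s - t\<close>.  The wanted coefficient is therefore
  the constant term of \<open>4^N v y^2 q^(-N)\<close>.

  Pass to the coordinates \<open>q\<close> and \<open>\<rho> = (P - M) / (P + M)\<close>, and let \<open>\<omega>\<close> be the ratio of
  \<open>dlog q \<and> dlog \<rho>\<close> to \<open>dlog v \<and> dlog y\<close>.  The constant term of \<open>q^i \<rho>^j \<omega>\<close> is 1 for \<open>i = j = 0\<close>
  and 0 otherwise, since all other forms are exact and the class for \<open>i = j = 0\<close> does not depend on the
  \<open>c_a\<close>.  The equations for \<open>s\<close> and \<open>t\<close> give, with \<open>\<Psi> = (\<phi>(s) - \<phi>(t)) / (s - t)\<close>,
  \<open>4 v y^2 q^(-N) = - q^(1-N) \<omega> (\<phi>'(s) \<phi>'(t) (1/\<rho> - \<rho>) / \<Psi> - \<phi>'(s) (1 + 1/\<rho>) - \<phi>'(t) (1/\<rho> - 1) + \<Psi>/\<rho>)\<close>.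
  As \<open>4 s = q (\<rho> + 2 + 1/\<rho>)\<close> and \<open>4 t = q (\<rho> - 2 + 1/\<rho>)\<close> are invariant under \<open>\<rho> \<mapsto> 1/\<rho>\<close>, the first term in
  the bracket is anti-invariant and contributes nothing; the others are linear in the \<open>c_a\<close>.
\<close>

section \<open>Power series in the variables c_a\<close>

definition mdeg :: "(nat \<Rightarrow>\<^sub>0 nat) \<Rightarrow> nat" where
  "mdeg m = (\<Sum>k\<in>Poly_Mapping.keys m. Poly_Mapping.lookup m k)"

lemma mdeg_0 [simp]: "mdeg 0 = 0"
  by (simp add: mdeg_def)

lemma mdeg_add: "mdeg (m + n) = mdeg m + mdeg n"
  unfolding mdeg_def by (rule setsum_keys_plus_distrib) auto

lemma mdeg_single [simp]: "mdeg (Poly_Mapping.single a k) = k"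
  by (cases "k = 0") (auto simp: mdeg_def)

lemma mdeg_eq_0_iff: "mdeg m = 0 \<longleftrightarrow> m = 0"
  by (auto simp: mdeg_def in_keys_iff intro!: poly_mapping_eqI)

text \<open>Both summands of \<open>m\<close> vanish outside the support of \<open>m\<close> and are
  bounded on it by \<open>mdeg m\<close>, which leaves finitely many functions. Every convolution
  sum is thus a genuine finite sum.\<close>

lemma finite_antidiagonal:
  "finite {p. fst p + snd p = (m :: nat \<Rightarrow>\<^sub>0 nat)}"
proof -
  let ?F = "{f. \<forall>x. (x \<in> Poly_Mapping.keys m \<longrightarrow> f x \<in> {..mdeg m}) \<and> (x \<notin> Poly_Mapping.keys m \<longrightarrow> f x = (0::nat))}"
  let ?G = "{n. Poly_Mapping.lookup n \<in> ?F}"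
  have le: "Poly_Mapping.lookup n x \<le> mdeg m" if "x \<in> Poly_Mapping.keys m" "n + n' = m" for n n' x
  proof -
    have "Poly_Mapping.lookup n x \<le> Poly_Mapping.lookup m x"
      using that by (auto simp: lookup_add)
    also have "\<dots> \<le> mdeg m" unfolding mdeg_def by (rule member_le_sum) (use that in auto)
    finally show ?thesis .
  qed
  have "finite ?F" by (rule finite_set_of_finite_funs) auto
  moreover have "inj_on Poly_Mapping.lookup ?G"
    by (auto simp: inj_on_def lookup_inject)
  ultimately have fG: "finite ?G"
    by (metis (no_types, lifting) finite_imageD finite_subset image_Collect_subsetI)
  have "a \<in> ?G \<and> b \<in> ?G" if "a + b = m" for a b
  proof -
    have "b + a = m" using that by (simp add: add.commute)
    moreover have "Poly_Mapping.lookup a x = 0 \<and> Poly_Mapping.lookup b x = 0" if "x \<notin> Poly_Mapping.keys m" for x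
      using that arg_cong[OF \<open>a + b = m\<close>, of "\<lambda>p. Poly_Mapping.lookup p x"] by (simp add: in_keys_iff lookup_add)
    ultimately show ?thesis using le that by simp
  qed
  then have "{p. fst p + snd p = m} \<subseteq> ?G \<times> ?G"
    by (intro subsetI) (metis (mono_tags, lifting) SigmaI mem_Collect_eq prod.collapse)
  then show ?thesis
    using fG finite_subset by blast
qed

text \<open>A type of its own, so that convolution can be the multiplication of a
  \<open>comm_ring_1\<close> instance.\<close>

typedef 'a mps = "UNIV :: ((nat \<Rightarrow>\<^sub>0 nat) \<Rightarrow> 'a) set"
  morphisms mps_nth Abs_mps ..

lemma mps_nth_Abs [simp]: "mps_nth (Abs_mps f) = f"
  by (simp add: Abs_mps_inverse)

lemma mps_eqI: "(\<And>m. mps_nth f m = mps_nth g m) \<Longrightarrow> f = g"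
  by (metis mps_nth_inverse ext)

instantiation mps :: (comm_ring_1) comm_ring_1
begin

definition "0 = Abs_mps (\<lambda>_. 0)"
definition "1 = Abs_mps (\<lambda>m. if m = 0 then 1 else 0)"
definition "f + g = Abs_mps (\<lambda>m. mps_nth f m + mps_nth g m)"
definition "f - g = Abs_mps (\<lambda>m. mps_nth f m - mps_nth g m)"
definition "- f = Abs_mps (\<lambda>m. - mps_nth f m)"
definition "f * g = Abs_mps (\<lambda>m. \<Sum>p\<in>{p. fst p + snd p = m}. mps_nth f (fst p) * mps_nth g (snd p))"

lemma mps_nth_0 [simp]: "mps_nth 0 m = 0"
  and mps_nth_1: "mps_nth 1 m = (if m = 0 then 1 else 0)"
  and mps_nth_add [simp]: "mps_nth (f + g) m = mps_nth f m + mps_nth g m"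
  and mps_nth_diff [simp]: "mps_nth (f - g) m = mps_nth f m - mps_nth g m"
  and mps_nth_uminus [simp]: "mps_nth (- f) m = - mps_nth f m"
  and mps_nth_mult: "mps_nth (f * g) m = (\<Sum>p\<in>{p. fst p + snd p = m}. mps_nth f (fst p) * mps_nth g (snd p))"
  for f g :: "'a mps"
  by (simp_all add: zero_mps_def one_mps_def plus_mps_def minus_mps_def uminus_mps_def times_mps_def)

instance
proof
  fix a b c :: "'a mps"
  show "a * b * c = a * (b * c)"
  proof (rule mps_eqI)
    fix m
    have "mps_nth (a * b * c) m = (\<Sum>p\<in>{p. fst p + snd p = m}. \<Sum>r\<in>{r. fst r + snd r = fst p}.
        mps_nth a (fst r) * mps_nth b (snd r) * mps_nth c (snd p))"
      by (simp add: mps_nth_mult sum_distrib_right)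
    also have "\<dots> = (\<Sum>(p, r)\<in>Sigma {p. fst p + snd p = m} (\<lambda>p. {r. fst r + snd r = fst p}).
        mps_nth a (fst r) * mps_nth b (snd r) * mps_nth c (snd p))"
      by (rule sum.Sigma) (auto simp: finite_antidiagonal)
    also have "\<dots> = (\<Sum>(p, r)\<in>Sigma {p. fst p + snd p = m} (\<lambda>p. {r. fst r + snd r = snd p}).
        mps_nth a (fst p) * (mps_nth b (fst r) * mps_nth c (snd r)))"
    \<comment> \<open>Both sides run over the decompositions of \<open>m\<close> into three
      monomials; the bijection regroups a splitting of the left summand as a splitting of the right
      one.\<close>
    proof (rule sum.reindex_bij_witness[of _
            "\<lambda>(p, r). ((fst p + fst r, snd r), (fst p, fst r))"
            "\<lambda>(p, r). ((fst r, snd r + snd p), (snd r, snd p))"], goal_cases)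
      case (1 x)
      then show ?case by (cases x) auto
    next
      case (2 x)
      then show ?case by (cases x) (auto simp flip: add.assoc)
    next
      case (3 x)
      then show ?case by (cases x) auto
    next
      case (4 x)
      then show ?case by (cases x) (auto simp: add.assoc)
    next
      case (5 x)
      show ?case by (cases x) (simp add: mult.assoc)
    qed
    also have "\<dots> = (\<Sum>p\<in>{p. fst p + snd p = m}. \<Sum>r\<in>{r. fst r + snd r = snd p}.
        mps_nth a (fst p) * (mps_nth b (fst r) * mps_nth c (snd r)))"
      by (rule sum.Sigma[symmetric]) (auto simp: finite_antidiagonal)
    also have "\<dots> = mps_nth (a * (b * c)) m"
      by (simp add: mps_nth_mult sum_distrib_left)
    finally show "mps_nth (a * b * c) m = mps_nth (a * (b * c)) m" .
  qed
  show "a * b = b * a"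
    by (rule mps_eqI, unfold mps_nth_mult, rule sum.reindex_bij_witness[of _ prod.swap prod.swap])
       (auto simp: add.commute mult.commute)
  show "1 * a = a"
  proof (rule mps_eqI)
    fix m
    have "mps_nth (1 * a) m = (\<Sum>p\<in>{p. fst p + snd p = m}. if p = (0, m) then mps_nth a m else 0)"
      unfolding mps_nth_mult by (rule sum.cong) (auto simp: mps_nth_1)
    then show "mps_nth (1 * a) m = mps_nth a m"
      by (simp add: finite_antidiagonal)
  qed
  show "(a + b) * c = a * c + b * c"
    by (rule mps_eqI) (simp add: mps_nth_mult distrib_right sum.distrib)
  show "0 \<noteq> (1 :: 'a mps)"
    by (metis mps_nth_0 mps_nth_1 zero_neq_one)
qed (auto intro!: mps_eqI simp: algebra_simps)

end

lemma mps_nth_sum: "mps_nth (sum f A) m = (\<Sum>x\<in>A. mps_nth (f x) m)"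
  by (induction A rule: infinite_finite_induct) auto

lemma mps_nth_mult_0: "mps_nth (f * g) 0 = mps_nth f 0 * mps_nth g (0 :: nat \<Rightarrow>\<^sub>0 nat)"
proof -
  have "fst p = 0 \<and> snd p = 0" if "fst p + snd p = 0" for p :: "(nat \<Rightarrow>\<^sub>0 nat) \<times> (nat \<Rightarrow>\<^sub>0 nat)"
    using arg_cong[OF that, of mdeg] by (simp add: mdeg_add mdeg_eq_0_iff)
  then have "{p. fst p + snd p = (0 :: nat \<Rightarrow>\<^sub>0 nat)} = {(0, 0)}"
    by (intro set_eqI) (metis (mono_tags, lifting) add.left_neutral fst_conv mem_Collect_eq prod.collapse singleton_iff snd_conv)
  then show ?thesis by (simp add: mps_nth_mult)
qed

definition mps_const :: "'a::comm_ring_1 \<Rightarrow> 'a mps" where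
  "mps_const c = Abs_mps (\<lambda>m. if m = 0 then c else 0)"

lemma mps_nth_const: "mps_nth (mps_const c) m = (if m = 0 then c else 0)"
  by (simp add: mps_const_def)

lemma mps_nth_const_mult [simp]: "mps_nth (mps_const c * f) m = c * mps_nth f m"
proof -
  have "mps_nth (mps_const c * f) m = (\<Sum>p\<in>{p. fst p + snd p = m}. if p = (0, m) then c * mps_nth f m else 0)"
    unfolding mps_nth_mult by (rule sum.cong) (auto simp: mps_nth_const)
  then show ?thesis
    by (simp add: finite_antidiagonal)
qed

lemma mps_const_0 [simp]: "mps_const 0 = 0"
  and mps_const_1 [simp]: "mps_const 1 = 1"
  and mps_const_add: "mps_const (a + b) = mps_const a + mps_const b"
  and mps_const_diff: "mps_const (a - b) = mps_const a - mps_const b"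
  and mps_const_uminus: "mps_const (- a) = - mps_const a"
  and mps_const_mult: "mps_const (a * b) = mps_const a * mps_const b"
  by (auto intro!: mps_eqI simp: mps_nth_const mps_nth_1)

lemma mps_const_power: "mps_const (a ^ n) = mps_const a ^ n"
  by (induction n) (auto simp: mps_const_mult)

lemma mps_const_of_nat: "mps_const (of_nat n) = of_nat n"
  by (induction n) (auto simp: mps_const_add)

lemma mps_const_of_int: "mps_const (of_int n) = of_int n"
  by (cases n rule: int_diff_cases) (simp add: mps_const_diff mps_const_of_nat)

lemma mps_nth_of_nat_mult [simp]: "mps_nth (of_nat n * f) m = of_nat n * mps_nth f m"
  using mps_nth_const_mult[of "of_nat n" f m] by (simp add: mps_const_of_nat)

lemma mps_nth_of_int_mult [simp]: "mps_nth (of_int n * f) m = of_int n * mps_nth f m"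
  using mps_nth_const_mult[of "of_int n" f m] by (simp add: mps_const_of_int)

lemma mps_nth_numeral_mult [simp]: "mps_nth (numeral n * f) m = numeral n * mps_nth f m"
  using mps_nth_of_nat_mult[of "numeral n" f m] by simp

section \<open>The c-adic filtration\<close>

definition mps_ord :: "nat \<Rightarrow> 'a::comm_ring_1 mps set" where
  "mps_ord n = {f. \<forall>m. mdeg m < n \<longrightarrow> mps_nth f m = 0}"

lemma mps_ordD: "f \<in> mps_ord n \<Longrightarrow> mdeg m < n \<Longrightarrow> mps_nth f m = 0"
  by (auto simp: mps_ord_def)

lemma mps_ord_0 [simp]: "f \<in> mps_ord 0" "0 \<in> mps_ord n"
  by (auto simp: mps_ord_def)

lemma mps_ord_add: "f \<in> mps_ord n \<Longrightarrow> g \<in> mps_ord n \<Longrightarrow> f + g \<in> mps_ord n"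
  and mps_ord_diff: "f \<in> mps_ord n \<Longrightarrow> g \<in> mps_ord n \<Longrightarrow> f - g \<in> mps_ord n"
  by (auto simp: mps_ord_def)

lemma mps_ord_mono: "f \<in> mps_ord n \<Longrightarrow> k \<le> n \<Longrightarrow> f \<in> mps_ord k"
  by (auto simp: mps_ord_def)

lemma mps_ord_mult: 
  assumes "f \<in> mps_ord n" "g \<in> mps_ord k"
  shows "f * g \<in> mps_ord (n + k)"
  unfolding mps_ord_def
proof (safe)
  fix m :: "nat \<Rightarrow>\<^sub>0 nat" assume m: "mdeg m < n + k"
  show "mps_nth (f * g) m = 0"
    unfolding mps_nth_mult
  proof (rule sum.neutral, safe)
    fix a b assume "m = fst (a, b) + snd (a, b)"
    with m have "mdeg a < n \<or> mdeg b < k" by (auto simp: mdeg_add)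
    with assms show "mps_nth f (fst (a, b)) * mps_nth g (snd (a, b)) = 0"
      by (auto simp: mps_ordD)
  qed
qed

lemma mps_ord_mult_left: "g \<in> mps_ord k \<Longrightarrow> f * g \<in> mps_ord k"
  using mps_ord_mult[of f 0 g k] by simp

lemma mps_ord_mult_right: "f \<in> mps_ord k \<Longrightarrow> f * g \<in> mps_ord k"
  using mps_ord_mult[of f k g 0] by simp

lemma mps_ord_mult_cong:
  assumes "f - f' \<in> mps_ord n" "g - g' \<in> mps_ord n"
  shows "f * g - f' * g' \<in> mps_ord n"
proof -
  have "f * g - f' * g' = (f - f') * g + f' * (g - g')" by (simp add: algebra_simps)
  then show ?thesis using assms by (auto intro: mps_ord_add mps_ord_mult_left mps_ord_mult_right)
qed

lemma mps_ord_power_cong: "f - g \<in> mps_ord n \<Longrightarrow> f ^ k - g ^ k \<in> mps_ord n"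
  by (induction k) (auto intro: mps_ord_mult_cong)

lemma mps_ord_power: "f \<in> mps_ord 1 \<Longrightarrow> f ^ k \<in> mps_ord k"
  by (induction k) (use mps_ord_mult[of f 1] in auto)

lemma mps_eq_0_if_ord: "(\<And>n. f \<in> mps_ord n) \<Longrightarrow> f = 0"
  by (rule mps_eqI) (auto intro: mps_ordD[of _ "Suc (mdeg _)"])

lemma mps_eq_if_ord: "(\<And>n. f - g \<in> mps_ord n) \<Longrightarrow> f = g"
  using mps_eq_0_if_ord[of "f - g"] by simp

lemma mps_ord_1I: "mps_nth f 0 = 0 \<Longrightarrow> f \<in> mps_ord 1"
  by (auto simp: mps_ord_def mdeg_eq_0_iff)

text \<open>The sum of all \<open>c_a * F a\<close>, which is locally finite for every family \<open>F\<close>.\<close>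
definition mps_csum :: "(nat \<Rightarrow> 'a::comm_ring_1 mps) \<Rightarrow> 'a mps" where
  "mps_csum F = Abs_mps (\<lambda>m. \<Sum>a\<in>Poly_Mapping.keys m. mps_nth (F a) (m - Poly_Mapping.single a 1))"

lemma mps_nth_csum:
  "mps_nth (mps_csum F) m = (\<Sum>a\<in>Poly_Mapping.keys m. mps_nth (F a) (m - Poly_Mapping.single a 1))"
  by (simp add: mps_csum_def)

lemma mdeg_diff_single:
  assumes "a \<in> Poly_Mapping.keys m"
  shows "Poly_Mapping.single a 1 + (m - Poly_Mapping.single a 1) = m"
    and "mdeg m = Suc (mdeg (m - Poly_Mapping.single a 1))"
proof -
  show *: "Poly_Mapping.single a 1 + (m - Poly_Mapping.single a 1) = m"
    using assms by (intro poly_mapping_eqI) (auto simp: lookup_add lookup_minus lookup_single in_keys_iff when_def)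
  show "mdeg m = Suc (mdeg (m - Poly_Mapping.single a 1))"
    using arg_cong[OF *, of mdeg] by (simp add: mdeg_add)
qed

lemma mps_csum_add: "mps_csum (\<lambda>a. F a + G a) = mps_csum F + mps_csum G"
  and mps_csum_diff: "mps_csum (\<lambda>a. F a - G a) = mps_csum F - mps_csum G"
  by (auto intro!: mps_eqI simp: mps_nth_csum sum.distrib sum_subtractf)

text \<open>The factor \<open>c_a\<close> in front of each member raises the order by one. The
  contraction property of \<open>Asub\<close> comes from here.\<close>

lemma mps_csum_ord:
  assumes "\<And>a. F a \<in> mps_ord n"
  shows "mps_csum F \<in> mps_ord (Suc n)"
  unfolding mps_ord_def
  by (auto simp: mps_nth_csum mdeg_diff_single(2) intro!: sum.neutral mps_ordD[OF assms])

lemma mps_csum_mult: "mps_csum (\<lambda>a. F a * g) = mps_csum F * g"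
proof (rule mps_eqI)
  fix m
  let ?e = "\<lambda>a. Poly_Mapping.single a (1::nat)"
  have "mps_nth (mps_csum F * g) m = (\<Sum>p\<in>{p. fst p + snd p = m}. \<Sum>a\<in>Poly_Mapping.keys (fst p).
          mps_nth (F a) (fst p - ?e a) * mps_nth g (snd p))"
    by (simp add: mps_nth_mult mps_nth_csum sum_distrib_right)
  also have "\<dots> = (\<Sum>(p, a)\<in>Sigma {p. fst p + snd p = m} (\<lambda>p. Poly_Mapping.keys (fst p)).
          mps_nth (F a) (fst p - ?e a) * mps_nth g (snd p))"
    by (rule sum.Sigma) (auto simp: finite_antidiagonal)
  also have "\<dots> = (\<Sum>(a, p)\<in>Sigma (Poly_Mapping.keys m) (\<lambda>a. {p. fst p + snd p = m - ?e a}).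
          mps_nth (F a) (fst p) * mps_nth g (snd p))"
  \<comment> \<open>The variable \<open>c_a\<close> is always stripped from the first factor of a
    decomposition of \<open>m\<close> and put back there.\<close>
  proof (rule sum.reindex_bij_witness[of _ "\<lambda>(a, p). ((?e a + fst p, snd p), a)"
            "\<lambda>(p, a). (a, (fst p - ?e a, snd p))"], goal_cases)
    case (1 x)
    then show ?case using mdeg_diff_single(1) by fastforce
  next
    case (2 x)
    obtain p1 p2 a where x: "x = ((p1, p2), a)" by (metis prod.collapse)
    from 2 x have "p1 + p2 = m" "a \<in> Poly_Mapping.keys p1" by auto
    moreover from this have "p1 - ?e a + p2 = m - ?e a"
      by (metis (no_types, lifting) add.assoc add_diff_cancel_left' mdeg_diff_single(1))
    ultimately show ?case by (auto simp: x in_keys_iff lookup_add)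
  next
    case (3 x)
    then show ?case by auto
  next
    case (4 x)
    obtain p1 p2 a where x: "x = (a, (p1, p2))" by (metis prod.collapse)
    from 4 x have *: "p1 + p2 = m - ?e a" "a \<in> Poly_Mapping.keys m" by auto
    have "?e a + p1 + p2 = m"
      using mdeg_diff_single(1)[OF *(2)] *(1) by (simp add: add.assoc)
    then show ?case by (auto simp: x in_keys_iff lookup_add)
  next
    case (5 x)
    then show ?case by auto
  qed
  also have "\<dots> = mps_nth (mps_csum (\<lambda>a. F a * g)) m"
    by (simp add: mps_nth_csum mps_nth_mult finite_antidiagonal flip: sum.Sigma)
  finally show "mps_nth (mps_csum (\<lambda>a. F a * g)) m = mps_nth (mps_csum F * g) m" by simp
qed

lemma mps_csum_mult_left: "mps_csum (\<lambda>a. g * F a) = g * mps_csum F"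
  using mps_csum_mult[of F g] by (simp add: mult.commute)

section \<open>Coefficientwise maps and the Euler derivation in the c_a\<close>

definition mps_map :: "('a \<Rightarrow> 'a) \<Rightarrow> 'a::comm_ring_1 mps \<Rightarrow> 'a mps" where
  "mps_map h f = Abs_mps (\<lambda>m. h (mps_nth f m))"

lemma mps_nth_map [simp]: "mps_nth (mps_map h f) m = h (mps_nth f m)"
  by (simp add: mps_map_def)

lemma mps_map_hom:
  assumes "additive h" "\<And>x y. h (x * y) = h x * h y"
  shows "mps_map h (f * g) = mps_map h f * mps_map h g"
  by (rule mps_eqI) (simp add: mps_nth_mult additive.sum[OF assms(1)] assms(2))

lemma mps_map_csum:
  assumes "additive h"
  shows "mps_map h (mps_csum F) = mps_csum (\<lambda>a. mps_map h (F a))"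
  by (rule mps_eqI) (simp add: mps_nth_csum additive.sum[OF assms(1)])

lemma mps_map_ord: "additive h \<Longrightarrow> f \<in> mps_ord n \<Longrightarrow> mps_map h f \<in> mps_ord n"
  by (auto simp: mps_ord_def additive.zero)

text \<open>The sum of all c_a d/dc_a, that is, t d/dt when all c_a are scaled by t.\<close>

definition mps_euler :: "'a::comm_ring_1 mps \<Rightarrow> 'a mps" where
  "mps_euler f = Abs_mps (\<lambda>m. of_nat (mdeg m) * mps_nth f m)"

lemma mps_nth_euler [simp]: "mps_nth (mps_euler f) m = of_nat (mdeg m) * mps_nth f m"
  by (simp add: mps_euler_def)

text \<open>Product rule; the summand \<open>mps_csum F\<close> comes from differentiating the
  factors \<open>c_a\<close>.\<close>

lemma mps_euler_csum: "mps_euler (mps_csum F) = mps_csum F + mps_csum (\<lambda>a. mps_euler (F a))"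
  by (rule mps_eqI)
     (auto simp: mps_nth_csum sum_distrib_left mdeg_diff_single(2) algebra_simps sum.distrib 
           simp flip: sum.distrib intro!: sum.cong)

section \<open>Derivations, units and the binomial series\<close>

locale derivation =
  fixes d :: "'a::comm_ring_1 \<Rightarrow> 'a"
  assumes add: "d (f + g) = d f + d g"
    and mult: "d (f * g) = d f * g + f * d g"
begin

lemma additive: "additive d"
  by (simp add: additive_def add)

lemmas zero [simp] = additive.zero[OF additive]
lemmas diff = additive.diff[OF additive]

lemma one [simp]: "d 1 = 0"
  using mult[of 1 1] by simp

lemma of_nat [simp]: "d (of_nat n) = 0"
  by (induction n) (auto simp: add)

lemma numeral [simp]: "d (numeral n) = 0"
  using of_nat[of "numeral n"] by simp

lemma numeral_mult [simp]: "d (numeral n * f) = numeral n * d f"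
  by (simp add: mult)

lemma power: "d (f ^ n) = of_nat n * f ^ (n - 1) * d f"
proof (induction n)
  case (Suc n)
  then show ?case by (cases n) (auto simp: mult algebra_simps)
qed auto

lemma inverse:
  assumes "f * f' = 1"
  shows "d f' = - f' * (f' * d f)"
proof -
  have "d f * f' + f * d f' = 0" using arg_cong[OF assms, of d] by (simp add: mult)
  then have "f' * (d f * f') + (f * f') * d f' = 0"
    by (metis (no_types, lifting) distrib_left mult.assoc mult.commute mult_zero_right)
  then show ?thesis using assms by (simp add: eq_neg_iff_add_eq_0 algebra_simps)
qed

end

lemma derivation_map:
  assumes "derivation h"
  shows "derivation (mps_map h)"
proof -
  interpret derivation h by fact
  show ?thesis
    by unfold_locales
       (auto intro!: mps_eqI simp: add mult mps_nth_mult additive.sum[OF additive] sum.distrib)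
qed

lemma derivation_euler: "derivation mps_euler"
proof
  fix f g :: "'a mps"
  show "mps_euler (f + g) = mps_euler f + mps_euler g"
    by (rule mps_eqI) (simp add: algebra_simps)
  show "mps_euler (f * g) = mps_euler f * g + f * mps_euler g"
  proof (rule mps_eqI)
    fix m
    have "mps_nth (mps_euler (f * g)) m = (\<Sum>p\<in>{p. fst p + snd p = m}.
        of_nat (mdeg (fst p)) * mps_nth f (fst p) * mps_nth g (snd p) +
        mps_nth f (fst p) * (of_nat (mdeg (snd p)) * mps_nth g (snd p)))"
      unfolding mps_nth_euler mps_nth_mult sum_distrib_left
      by (rule sum.cong) (auto simp: mdeg_add algebra_simps)
    then show "mps_nth (mps_euler (f * g)) m = mps_nth (mps_euler f * g + f * mps_euler g) m"
      by (simp add: mps_nth_mult sum.distrib)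
  qed
qed

lemma additive_of_nat_mult: 
  fixes h :: "'a::comm_ring_1 \<Rightarrow> 'b::comm_ring_1"
  shows "additive h \<Longrightarrow> h (of_nat n * x) = of_nat n * h x"
  by (induction n) (auto simp: distrib_right additive.add additive.zero)

lemma mps_map_euler_commute:
  "additive h \<Longrightarrow> mps_map h (mps_euler f) = mps_euler (mps_map h f)"
  by (rule mps_eqI) (simp add: additive_of_nat_mult)

text \<open>Integer powers of a unit \<open>u\<close> with inverse \<open>u'\<close>.\<close>
definition upow :: "'a::comm_ring_1 \<Rightarrow> 'a \<Rightarrow> int \<Rightarrow> 'a" where
  "upow u u' i = (if i \<ge> 0 then u ^ nat i else u' ^ nat (- i))"

lemma upow_0 [simp]: "upow u u' 0 = 1"
  and upow_1 [simp]: "upow u u' 1 = u"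
  and upow_minus_1 [simp]: "upow u u' (-1) = u'"
  and upow_of_nat [simp]: "upow u u' (int n) = u ^ n"
  and upow_minus_of_nat [simp]: "upow u u' (- int n) = u' ^ n"
  by (auto simp: upow_def)

lemma upow_plus_1:
  assumes "u * u' = 1"
  shows "upow u u' (i + 1) = upow u u' i * u"
proof -
  consider "i \<ge> 0" | "i = -1" | n where "i = - int (Suc (Suc n))"
    by (metis (no_types, opaque_lifting) add.commute int_cases of_nat_0_le_iff of_nat_Suc old.nat.exhaust of_nat_0 add_0)
  then show ?thesis
  proof cases
    case 1
    then show ?thesis by (simp add: upow_def nat_add_distrib mult.commute)
  next
    case 2
    then show ?thesis using assms by (simp add: mult.commute)
  next
    case 3
    have "i + 1 = - int (Suc n)" using 3 by simp
    moreover have "u' ^ Suc n = u' ^ Suc (Suc n) * u"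
      using assms by (metis mult.assoc mult.commute mult.right_neutral power_Suc2)
    ultimately show ?thesis using 3 by (simp only: upow_minus_of_nat)
  qed
qed

lemma upow_add:
  assumes "u * u' = 1"
  shows "upow u u' (i + j) = upow u u' i * upow u u' j"
proof (induction j rule: int_induct[where k = 0])
  case base
  then show ?case by simp
next
  case (step1 j)
  then show ?case using upow_plus_1[OF assms] by (simp add: mult.assoc flip: add.assoc)
next
  case (step2 j)
  have "upow u u' (i + j) = upow u u' (i + (j - 1)) * u" "upow u u' j = upow u u' (j - 1) * u"
    using upow_plus_1[OF assms, of "i + (j - 1)"] upow_plus_1[OF assms, of "j - 1"] by simp_all
  then have "upow u u' (i + (j - 1)) * u * u' = upow u u' i * upow u u' (j - 1) * u * u'"
    using step2 by (simp add: mult.assoc)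
  then show ?case using assms by (simp add: mult.assoc)
qed

lemma (in derivation) upow:
  assumes "u * u' = 1"
  shows "d (upow u u' i) = of_int i * upow u u' i * (u' * d u)"
proof (cases "i \<ge> 0")
  case True
  then obtain n where n: "i = int n" using nonneg_int_cases by blast
  \<comment> \<open>The factor \<open>of_nat n\<close> takes care of \<open>n = 0\<close>, where the
    exponent \<open>n - 1\<close> is truncated.\<close>
  have "of_nat n * u ^ (n - 1) = of_nat n * (u ^ n * u')"
    using assms by (cases n) (simp_all, metis mult.assoc mult.commute mult.right_neutral)
  then show ?thesis by (simp add: n power mult.assoc)
next
  case False
  then obtain n where n: "i = - int (Suc n)"
    by (metis int_cases of_nat_0_le_iff)
  show ?thesis
    unfolding n upow_minus_of_nat power inverse[OF assms] by (simp add: algebra_simps)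
qed

text \<open>The value of the power series with coefficients \<open>b\<close> at \<open>f\<close>, provided that \<open>f\<close> has no constant term.\<close>
definition mps_eval :: "(nat \<Rightarrow> 'a::comm_ring_1) \<Rightarrow> 'a mps \<Rightarrow> 'a mps" where
  "mps_eval b f = Abs_mps (\<lambda>m. \<Sum>k\<le>mdeg m. b k * mps_nth (f ^ k) m)"

lemma mps_nth_eval:
  assumes "f \<in> mps_ord 1" "mdeg m < n"
  shows "mps_nth (mps_eval b f) m = mps_nth (\<Sum>k<n. mps_const (b k) * f ^ k) m"
proof -
  have "(\<Sum>k<n. b k * mps_nth (f ^ k) m) = (\<Sum>k\<le>mdeg m. b k * mps_nth (f ^ k) m)"
    using assms(2) mps_ordD[OF mps_ord_power[OF assms(1)], of m]
    by (intro sum.mono_neutral_right) (auto simp: not_le)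
  then show ?thesis by (simp add: mps_eval_def mps_nth_sum)
qed

lemma mps_eval_ord:
  assumes "f \<in> mps_ord 1"
  shows "mps_eval b f - (\<Sum>k<n. mps_const (b k) * f ^ k) \<in> mps_ord n"
  using mps_nth_eval[OF assms] by (simp add: mps_ord_def)

text \<open>Coefficients transform as for a power series in one variable; this is checked modulo
  each order on truncations.\<close>

lemma mps_eval_mult_one_plus:
  assumes "f \<in> mps_ord 1"
  shows "mps_eval b f * (1 + f) = mps_eval (\<lambda>k. b k + (if k = 0 then 0 else b (k - 1))) f"
    (is "_ = mps_eval ?b f")
proof (rule mps_eq_if_ord)
  fix n
  let ?S = "\<lambda>b n. \<Sum>k<n. mps_const (b k) * f ^ k"
  have "?S b (Suc n) * (1 + f) - ?S ?b (Suc n) = mps_const (b n) * f ^ Suc n"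
    by (induction n) (auto simp: algebra_simps mps_const_add)
  also have "\<dots> \<in> mps_ord n"
    by (meson mps_ord_mult_left assms le_SucI mps_ord_mono mps_ord_power order_refl)
  \<comment> \<open>Truncation at \<open>Suc n\<close> leaves one uncancelled term, a multiple of
    \<open>f ^ Suc n\<close>.\<close>
  finally have 1: "?S b (Suc n) * (1 + f) - ?S ?b (Suc n) \<in> mps_ord n" .
  have "mps_eval b f * (1 + f) - mps_eval ?b f = (mps_eval b f - ?S b (Suc n)) * (1 + f)
      - (mps_eval ?b f - ?S ?b (Suc n)) + (?S b (Suc n) * (1 + f) - ?S ?b (Suc n))"
    by (simp only: algebra_simps)
  also have "\<dots> \<in> mps_ord n"
    by (intro mps_ord_add mps_ord_diff mps_ord_mult_right 1 mps_ord_mono[OF mps_eval_ord[OF assms], of n "Suc n"]) simp_all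
  finally show "mps_eval b f * (1 + f) - mps_eval ?b f \<in> mps_ord n" .
qed

lemma mps_eval_eq_1:
  assumes "f \<in> mps_ord 1"
  shows "mps_eval (\<lambda>k. if k = 0 then 1 else 0) f = 1"
  by (rule mps_eqI) (simp add: mps_eval_def if_distrib[of "\<lambda>x. x * _"] cong: if_cong)

text \<open>Geometric series: \<open>x = g * (1 + f)\<close> with \<open>f\<close> free of constant
  term.\<close>

lemma mps_unit:
  assumes "x - g \<in> mps_ord 1" "g * g' = 1"
  obtains x' where "x * x' = 1"
proof -
  define f where "f = x * g' - 1"
  have "f = (x - g) * g'" using assms by (simp add: f_def algebra_simps)
  then have f: "f \<in> mps_ord 1" using assms mps_ord_mult_right by metis
  have "(\<lambda>k. (-1) ^ k + (if k = 0 then 0 else (-1) ^ (k - 1))) = (\<lambda>k. if k = 0 then 1 else (0::'a))"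
  proof
    fix k show "(-1) ^ k + (if k = 0 then 0 else (-1) ^ (k - 1)) = (if k = 0 then 1 else (0::'a))"
      by (cases k) auto
  qed
  then have "mps_eval (\<lambda>k. (-1) ^ k) f * (1 + f) = 1"
    using mps_eval_mult_one_plus[OF f, of "\<lambda>k. (-1) ^ k"] mps_eval_eq_1[OF f] by simp
  then have "x * (g' * mps_eval (\<lambda>k. (-1) ^ k) f) = 1"
    by (simp add: f_def ac_simps)
  then show ?thesis using that by blast
qed

text \<open>Induction on \<open>N\<close>: by Pascal's rule for generalized binomials,
  multiplication by \<open>1 + f\<close> turns the series for exponent \<open>- Suc N\<close> into
  the one for \<open>- N\<close>. The map \<open>h\<close> carries rational coefficients into the
  ring.\<close>

lemma mps_eval_gbinomial:
  fixes f :: "'a::comm_ring_1 mps" and h :: "rat \<Rightarrow> 'a"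
  assumes f: "f \<in> mps_ord 1" and h: "additive h" "h 1 = 1"
  shows "mps_eval (\<lambda>k. h ((- of_nat N :: rat) gchoose k)) f * (1 + f) ^ N = 1"
proof (induction N)
  case 0
  have "(\<lambda>k. h ((- of_nat 0 :: rat) gchoose k)) = (\<lambda>k. if k = 0 then 1 else 0)"
    using h by (auto simp: fun_eq_iff gbinomial_0_left additive.zero)
  then show ?case using mps_eval_eq_1[OF f] by simp
next
  case (Suc N)
  have *: "((- rat_of_nat (Suc N)) gchoose k) + (if k = 0 then 0 else ((- of_nat (Suc N)) gchoose (k - 1)))
    = ((- of_nat N) gchoose k)" for k
  proof (cases k)
    case (Suc j)
    then show ?thesis using gbinomial_Suc_Suc[of "- rat_of_nat (Suc N)" j] by (simp add: add.commute)
  qed simp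
  have "(\<lambda>k. h ((- rat_of_nat (Suc N)) gchoose k) + (if k = 0 then 0 else h ((- of_nat (Suc N)) gchoose (k - 1))))
    = (\<lambda>k. h ((- of_nat N) gchoose k))"
  proof
    fix k
    show "h ((- rat_of_nat (Suc N)) gchoose k) + (if k = 0 then 0 else h ((- of_nat (Suc N)) gchoose (k - 1)))
    = h ((- of_nat N) gchoose k)"
      using arg_cong[OF *[of k], of h] by (cases "k = 0") (simp_all add: additive.add[OF h(1)])
  qed
  then have "mps_eval (\<lambda>k. h ((- rat_of_nat (Suc N)) gchoose k)) f * (1 + f)
    = mps_eval (\<lambda>k. h ((- of_nat N) gchoose k)) f"
    using mps_eval_mult_one_plus[OF f, of "\<lambda>k. h ((- rat_of_nat (Suc N)) gchoose k)"] by simp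
  then show ?case using Suc.IH by (metis (no_types, lifting) mult.assoc power_Suc)
qed

section \<open>Operators on Laurent polynomials\<close>

text \<open>Operators diagonal on monomials: additive weights give derivations such as v d/dv and y
  d/dy, multiplicative ones give ring homomorphisms such as y := -y.\<close>

definition lwt :: "(int \<times> int \<Rightarrow> rat) \<Rightarrow> laur \<Rightarrow> laur" where
  "lwt w p = Poly_Mapping.mapp (\<lambda>k c. w k * c) p"

lemma lookup_lwt [simp]: "Poly_Mapping.lookup (lwt w p) k = w k * Poly_Mapping.lookup p k"
  by (simp add: lwt_def lookup_mapp in_keys_iff when_def)

lemma additive_lwt: "additive (lwt w)"
  by unfold_locales (rule poly_mapping_eqI, simp add: lookup_add algebra_simps)

lemma lwt_single [simp]: "lwt w (Poly_Mapping.single k c) = Poly_Mapping.single k (w k * c)"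
  by (rule poly_mapping_eqI) (simp add: lookup_single when_def)

lemma poly_mapping_sum_singles:
  "p = (\<Sum>k\<in>Poly_Mapping.keys p. Poly_Mapping.single k (Poly_Mapping.lookup p k))"
  by (rule poly_mapping_eqI) (auto simp: lookup_sum lookup_single when_def in_keys_iff)

lemma additive_poly_mapping_eqI:
  fixes f g :: "('a \<Rightarrow>\<^sub>0 'b::ab_group_add) \<Rightarrow> 'c::ab_group_add"
  assumes "additive f" "additive g"
    and "\<And>k c. f (Poly_Mapping.single k c) = g (Poly_Mapping.single k c)"
  shows "f p = g p"
proof -
  have "f (\<Sum>k\<in>A. Poly_Mapping.single k (h k)) = g (\<Sum>k\<in>A. Poly_Mapping.single k (h k))" for h A
    by (simp add: additive.sum[OF assms(1)] additive.sum[OF assms(2)] assms(3))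
  then show ?thesis by (metis poly_mapping_sum_singles)
qed

lemma biadditive_poly_mapping_eqI:
  fixes f g :: "('a \<Rightarrow>\<^sub>0 'b::ab_group_add) \<Rightarrow> ('a \<Rightarrow>\<^sub>0 'b) \<Rightarrow> 'c::ab_group_add"
  assumes "\<And>q. additive (\<lambda>p. f p q)" "\<And>q. additive (\<lambda>p. g p q)"
    and "\<And>p. additive (f p)" "\<And>p. additive (g p)"
    and "\<And>k c l e. f (Poly_Mapping.single k c) (Poly_Mapping.single l e) =
        g (Poly_Mapping.single k c) (Poly_Mapping.single l e)"
  shows "f p q = g p q"
proof (rule additive_poly_mapping_eqI[of "\<lambda>p. f p q" "\<lambda>p. g p q"])
  show "f (Poly_Mapping.single k c) q = g (Poly_Mapping.single k c) q" for k c
    by (rule additive_poly_mapping_eqI[of "f (Poly_Mapping.single k c)" "g (Poly_Mapping.single k c)"])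
       (fact assms)+
qed (fact assms)+

lemma derivation_lwt:
  assumes "\<And>k l. w (k + l) = w k + w l"
  shows "derivation (lwt w)"
proof
  note [simp] = additive.add[OF additive_lwt]
  show "lwt w (f + g) = lwt w f + lwt w g" for f g by simp
  show "lwt w (f * g) = lwt w f * g + f * lwt w g" for f g
    by (rule biadditive_poly_mapping_eqI[of "\<lambda>f g. lwt w (f * g)" "\<lambda>f g. lwt w f * g + f * lwt w g"])
       (auto simp: additive_def algebra_simps mult_single assms single_add)
qed

lemma lwt_hom:
  assumes "\<And>k l. w (k + l) = w k * w l"
  shows "lwt w (f * g) = lwt w f * lwt w g"
proof -
  note [simp] = additive.add[OF additive_lwt]
  show ?thesis
    by (rule biadditive_poly_mapping_eqI[of "\<lambda>f g. lwt w (f * g)" "\<lambda>f g. lwt w f * lwt w g"])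
       (auto simp: additive_def algebra_simps mult_single assms)
qed

lemma mon_mult: "mon i j * mon k l = mon (i + k) (j + l)"
  by (simp add: mon_def mult_single)

lemma mon_0_0: "mon 0 0 = 1"
  by (simp add: mon_def flip: zero_prod_def)

lemma mon_power: "mon i j ^ n = mon (int n * i) (int n * j)"
  by (induction n) (auto simp: mon_0_0 mon_mult algebra_simps)

lemma lookup_mon_mult:
  "Poly_Mapping.lookup (mon i j * p) (k, l) = Poly_Mapping.lookup p (k - i, l - j)"
  unfolding mon_def
  by (rule additive_poly_mapping_eqI[where p = p and f = "\<lambda>p. Poly_Mapping.lookup (Poly_Mapping.single (i, j) 1 * p) (k, l)"])
     (auto simp: additive_def lookup_add algebra_simps mult_single lookup_single when_def)

abbreviation vwt :: "laur \<Rightarrow> laur" where "vwt \<equiv> lwt (\<lambda>k. of_int (fst k))"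
abbreviation ywt :: "laur \<Rightarrow> laur" where "ywt \<equiv> lwt (\<lambda>k. of_int (snd k))"

lemma dyL_eq: "dyL p = mon 0 (-2) * ywt p"
proof -
  have "mon 0 (-2) * ywt p = mon 0 (-2) * ywt (\<Sum>k\<in>Poly_Mapping.keys p. Poly_Mapping.single k (Poly_Mapping.lookup p k))"
    using poly_mapping_sum_singles[of p] by simp
  also have "\<dots> = dyL p"
    unfolding additive.sum[OF additive_lwt] sum_distrib_left dyL_def
    by (auto simp: mon_def mult_single intro!: sum.cong)
  finally show ?thesis by simp
qed

lemma flipL_eq: "flipL p = lwt (\<lambda>k. if even (snd k) then 1 else - 1) p"
proof -
  have "lwt (\<lambda>k. if even (snd k) then 1 else - 1) p = lwt (\<lambda>k. if even (snd k) then 1 else - 1) (\<Sum>k\<in>Poly_Mapping.keys p. Poly_Mapping.single k (Poly_Mapping.lookup p k))"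
    using poly_mapping_sum_singles[of p] by simp
  also have "\<dots> = flipL p"
    unfolding additive.sum[OF additive_lwt] flipL_def
    by (auto intro!: sum.cong)
  finally show ?thesis by simp
qed

lemma additive_flipL: "additive flipL"
  using additive_lwt by (simp add: flipL_eq[abs_def])

lemma flipL_mult: "flipL (p * q) = flipL p * flipL q"
  unfolding flipL_eq by (rule lwt_hom) auto

lemma flipL_single: "flipL (Poly_Mapping.single k c) = Poly_Mapping.single k (if even (snd k) then c else - c)"
  by (simp add: flipL_eq)

type_synonym lser = "laur mps"

definition theta_v :: "lser \<Rightarrow> lser" where "theta_v = mps_map vwt"
definition theta_y :: "lser \<Rightarrow> lser" where "theta_y = mps_map ywt"
definition flip :: "lser \<Rightarrow> lser" where "flip = mps_map flipL"
definition cmon :: "int \<Rightarrow> int \<Rightarrow> lser" where "cmon i j = mps_const (mon i j)"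
definition rat_ser :: "rat \<Rightarrow> lser" where "rat_ser r = mps_const (lconst r)"

interpretation theta_v: derivation theta_v
  unfolding theta_v_def by (intro derivation_map derivation_lwt) auto

interpretation theta_y: derivation theta_y
  unfolding theta_y_def by (intro derivation_map derivation_lwt) auto

interpretation eul: derivation "mps_euler :: lser \<Rightarrow> lser"
  by (rule derivation_euler)

lemma theta_v_theta_y_commute: "theta_v (theta_y f) = theta_y (theta_v f)"
  by (auto intro!: mps_eqI poly_mapping_eqI simp: theta_v_def theta_y_def)

lemma theta_v_euler_commute: "theta_v (mps_euler f) = mps_euler (theta_v f)"
  and theta_y_euler_commute: "theta_y (mps_euler f) = mps_euler (theta_y f)"
  unfolding theta_v_def theta_y_def by (rule mps_map_euler_commute, rule additive_lwt)+

lemma theta_v_csum: "theta_v (mps_csum F) = mps_csum (\<lambda>a. theta_v (F a))"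
  and theta_y_csum: "theta_y (mps_csum F) = mps_csum (\<lambda>a. theta_y (F a))"
  unfolding theta_v_def theta_y_def by (rule mps_map_csum, rule additive_lwt)+

lemma theta_y_ord: "f \<in> mps_ord n \<Longrightarrow> theta_y f \<in> mps_ord n"
  unfolding theta_y_def by (rule mps_map_ord, rule additive_lwt)

lemma flip_add [simp]: "flip (f + g) = flip f + flip g"
  and flip_diff [simp]: "flip (f - g) = flip f - flip g"
  and flip_mult [simp]: "flip (f * g) = flip f * flip g"
  and flip_csum: "flip (mps_csum F) = mps_csum (\<lambda>a. flip (F a))"
  and flip_ord: "f \<in> mps_ord n \<Longrightarrow> flip f \<in> mps_ord n"
proof -
  show "flip (f + g) = flip f + flip g" "flip (f - g) = flip f - flip g"
    by (auto intro!: mps_eqI simp: flip_def additive.add[OF additive_flipL] additive.diff[OF additive_flipL])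
  show "flip (f * g) = flip f * flip g"
    unfolding flip_def by (intro mps_map_hom additive_flipL flipL_mult)
  show "flip (mps_csum F) = mps_csum (\<lambda>a. flip (F a))"
    unfolding flip_def by (intro mps_map_csum additive_flipL)
  show "f \<in> mps_ord n \<Longrightarrow> flip f \<in> mps_ord n"
    unfolding flip_def by (intro mps_map_ord additive_flipL)
qed

lemma flip_cmon: "flip (cmon i j) = (if even j then cmon i j else - cmon i j)"
  by (auto intro!: mps_eqI simp: flip_def cmon_def mps_nth_const flipL_single mon_def additive.zero[OF additive_flipL]
      additive.minus[OF additive_flipL] simp flip: single_uminus mps_const_uminus)

lemma flip_1 [simp]: "flip 1 = 1"
  using flip_cmon[of 0 0] by (simp add: cmon_def mon_0_0)

lemma flip_power [simp]: "flip (f ^ n) = flip f ^ n"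
  by (induction n) auto

lemma theta_v_flip: "theta_v (flip f) = flip (theta_v f)" and theta_y_flip: "theta_y (flip f) = flip (theta_y f)"
  by (auto intro!: mps_eqI poly_mapping_eqI simp: theta_v_def theta_y_def flip_def flipL_eq)

lemma cmon_mult: "cmon i j * cmon k l = cmon (i + k) (j + l)"
  by (simp add: cmon_def mon_mult flip: mps_const_mult)

lemma cmon_0_0 [simp]: "cmon 0 0 = 1"
  by (simp add: cmon_def mon_0_0)

lemma cmon_power: "cmon i j ^ n = cmon (int n * i) (int n * j)"
  by (simp add: cmon_def mon_power flip: mps_const_power)

lemma theta_v_cmon [simp]: "theta_v (cmon i j) = of_int i * cmon i j"
  and theta_y_cmon [simp]: "theta_y (cmon i j) = of_int j * cmon i j"
  by (auto intro!: mps_eqI poly_mapping_eqI simp: theta_v_def theta_y_def cmon_def mps_nth_const mon_def mult_single lookup_single when_def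
     simp flip: single_of_int)

lemma euler_const [simp]: "mps_euler (mps_const c) = 0"
  by (rule mps_eqI) (simp add: mps_nth_const)

lemma euler_cmon [simp]: "mps_euler (cmon i j) = 0"
  by (simp add: cmon_def)

text \<open>The logarithmic derivatives \<open>theta_v = v d/dv\<close> and \<open>theta_y = y d/dy\<close> have no constant term, so
  \<open>CT\<close> is the residue of the form \<open>f dlog v \<and> dlog y\<close>.\<close>
definition CT :: "lser \<Rightarrow> (nat \<Rightarrow>\<^sub>0 nat) \<Rightarrow> rat" where
  "CT f m = Poly_Mapping.lookup (mps_nth f m) (0, 0)"

lemma CT_add: "CT (f + g) m = CT f m + CT g m"
  and CT_diff: "CT (f - g) m = CT f m - CT g m"
  and CT_zero [simp]: "CT 0 m = 0"
  and CT_csum: "CT (mps_csum F) m = (\<Sum>a\<in>Poly_Mapping.keys m. CT (F a) (m - Poly_Mapping.single a 1))"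
  and CT_theta_v [simp]: "CT (theta_v f) m = 0"
  and CT_theta_y [simp]: "CT (theta_y f) m = 0"
  by (simp_all add: CT_def lookup_add lookup_minus mps_nth_csum lookup_sum theta_v_def theta_y_def)

lemma CT_of_int_mult: "CT (of_int n * f) m = of_int n * CT f m"
  by (cases n rule: int_diff_cases)
     (simp add: CT_def left_diff_distrib lookup_minus additive_of_nat_mult[of "\<lambda>p. Poly_Mapping.lookup p (0, 0)"]
       additive_def lookup_add)

lemma CT_euler: "CT (mps_euler f) m = of_nat (mdeg m) * CT f m"
  by (simp add: CT_def additive_of_nat_mult[of "\<lambda>p. Poly_Mapping.lookup p (0, 0)"] additive_def lookup_add)

lemma CT_cmon_mult: "CT (cmon i j * f) m = Poly_Mapping.lookup (mps_nth f m) (- i, - j)"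
  by (simp add: CT_def cmon_def lookup_mon_mult)

lemma additive_lconst: "additive lconst"
  by unfold_locales (simp add: lconst_def single_add)

lemma rat_ser_mult: "rat_ser r * rat_ser q = rat_ser (r * q)"
  and rat_ser_1 [simp]: "rat_ser 1 = 1"
  and rat_ser_of_int: "rat_ser (of_int n) = of_int n"
  by (simp_all add: rat_ser_def lconst_def mult_single mps_const_of_int flip: mps_const_mult zero_prod_def)

section \<open>Lagrange inversion\<close>

text \<open>Banach's fixed point argument in the c-adic topology: each application of
  \<open>\<Phi>\<close> improves agreement by one order, so the iterates of 0 converge.\<close>

lemma mps_fixpoint:
  fixes \<Phi> :: "'a::comm_ring_1 mps \<Rightarrow> 'a mps"
  assumes ord: "\<And>f. f \<in> mps_ord 1 \<Longrightarrow> \<Phi> f \<in> mps_ord 1"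
    and contr: "\<And>n f g. f \<in> mps_ord 1 \<Longrightarrow> g \<in> mps_ord 1 \<Longrightarrow> f - g \<in> mps_ord n \<Longrightarrow> \<Phi> f - \<Phi> g \<in> mps_ord (Suc n)"
  obtains e where "e \<in> mps_ord 1" "\<Phi> e = e"
proof -
  let ?s = "\<lambda>n. (\<Phi> ^^ n) 0"
  have ord': "(\<Phi> ^^ n) f \<in> mps_ord 1" if "f \<in> mps_ord 1" for n f
    using that by (induction n) (auto intro: ord[simplified])
  have diff: "(\<Phi> ^^ n) f - ?s n \<in> mps_ord n" if "f \<in> mps_ord 1" for n f
    by (induction n) (auto intro!: contr ord'[simplified] that[simplified])
  \<comment> \<open>From iterate \<open>Suc (mdeg m)\<close> on, the coefficient at \<open>m\<close>
    no longer changes.\<close>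
  define e where "e = Abs_mps (\<lambda>m. mps_nth (?s (Suc (mdeg m))) m)"
  have es: "e - ?s n \<in> mps_ord n" for n
    unfolding mps_ord_def
  proof (safe)
    fix m :: "nat \<Rightarrow>\<^sub>0 nat" assume m: "mdeg m < n"
    then obtain k where k: "n = Suc (mdeg m) + k" by (metis Suc_leI le_iff_add)
    have "?s n = (\<Phi> ^^ Suc (mdeg m)) (?s k)" by (simp only: k funpow_add o_apply)
    then have "?s n - ?s (Suc (mdeg m)) \<in> mps_ord (Suc (mdeg m))"
      using diff[OF ord'[of 0 k]] by (simp del: funpow.simps)
    from mps_ordD[OF this, of m] show "mps_nth (e - ?s n) m = 0"
      by (simp add: e_def del: funpow.simps)
  qed
  have e1: "e \<in> mps_ord 1"
  proof -
    have "e = (e - ?s 1) + ?s 1" by simp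
    then show ?thesis using es[of 1] ord'[of 0 1] mps_ord_add by (metis mps_ord_0(2))
  qed
  have "\<Phi> e = e"
  proof (rule mps_eq_if_ord)
    fix n
    have "\<Phi> e - e = (\<Phi> e - \<Phi> (?s n)) - (e - ?s (Suc n))" by simp
    moreover have "\<Phi> e - \<Phi> (?s n) \<in> mps_ord (Suc n)" by (intro contr e1 ord' es) simp
    ultimately show "\<Phi> e - e \<in> mps_ord n"
      using es[of "Suc n"] by (metis mps_ord_diff mps_ord_mono le_SucI order_refl)
  qed
  with e1 show ?thesis using that by blast
qed

section \<open>The implicit equation for Y\<close>

definition Pser :: "lser \<Rightarrow> lser" where "Pser s = mps_csum (\<lambda>a. s ^ a)"
text \<open>The formal derivative of P at \<open>s\<close>; for \<open>a = 0\<close> the truncated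
  exponent is harmless because the factor \<open>of_nat a\<close> vanishes.\<close>

definition Pser' :: "lser \<Rightarrow> lser" where "Pser' s = mps_csum (\<lambda>a. of_nat a * s ^ (a - 1))"

abbreviation (input) vv :: lser where "vv \<equiv> cmon 1 0"
abbreviation (input) vi :: lser where "vi \<equiv> cmon (-1) 0"
abbreviation (input) yy :: lser where "yy \<equiv> cmon 0 1"
abbreviation (input) yi :: lser where "yi \<equiv> cmon 0 (-1)"

lemma theta_v_Pser: "theta_v (Pser s) = Pser' s * theta_v s"
  and theta_y_Pser: "theta_y (Pser s) = Pser' s * theta_y s"
  and euler_Pser: "mps_euler (Pser s) = Pser s + Pser' s * mps_euler s"
  by (simp_all add: Pser_def Pser'_def theta_v_csum theta_y_csum mps_euler_csum theta_v.power theta_y.power eul.power mps_csum_mult)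

lemma Pser_ord: "Pser s \<in> mps_ord 1" and Pser'_ord: "Pser' s \<in> mps_ord 1"
  using mps_csum_ord[of "\<lambda>a. s ^ a" 0] mps_csum_ord[of "\<lambda>a. of_nat a * s ^ (a - 1)" 0]
  by (simp_all add: Pser_def Pser'_def)

lemma Pser_cong: "s - t \<in> mps_ord n \<Longrightarrow> Pser s - Pser t \<in> mps_ord (Suc n)"
  unfolding Pser_def by (simp flip: mps_csum_diff add: mps_csum_ord mps_ord_power_cong)

definition Asub :: "lser \<Rightarrow> lser" where "Asub Y = vi * Pser (vv * (1 + Y)\<^sup>2)"

lemma Asub_ord: "Asub Y \<in> mps_ord 1"
  by (simp add: Asub_def mps_ord_mult_left Pser_ord[simplified])

lemma Asub_cong: 
  assumes "f - g \<in> mps_ord n" shows "Asub f - Asub g \<in> mps_ord (Suc n)"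
proof -
  have "vv * (1 + f)\<^sup>2 - vv * (1 + g)\<^sup>2 \<in> mps_ord n"
    using assms by (simp only: flip: right_diff_distrib) (intro mps_ord_mult_left mps_ord_power_cong, simp)
  then show ?thesis
    unfolding Asub_def by (simp flip: right_diff_distrib add: Pser_cong mps_ord_mult_left)
qed

lemma rat_ser_half: "rat_ser (1/2) * (2 * x) = x"
proof -
  have "rat_ser (1/2) * 2 = 1" using rat_ser_mult[of "1/2" 2] rat_ser_of_int[of 2] by simp
  then show ?thesis by (simp flip: mult.assoc)
qed

lemma two_cancel: "2 * x = 2 * y \<Longrightarrow> x = (y :: lser)"
  by (metis rat_ser_half)

text \<open>With Y = y + e the equation reads e = (A(y + e) - e^2/2)/y. The right side contracts:
  \<open>Asub\<close> gains an order, and f^2 - g^2 = (f - g)(f + g) gains one from the factor f +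
  g.\<close>

lemma Yp_exists: "\<exists>Y. Y - yy \<in> mps_ord 1 \<and> Y\<^sup>2 = yy\<^sup>2 + 2 * Asub Y"
proof -
  define \<Phi> where "\<Phi> e = yi * (Asub (yy + e) - rat_ser (1/2) * e\<^sup>2)" for e
  obtain e where e: "e \<in> mps_ord 1" "\<Phi> e = e"
  proof (rule mps_fixpoint)
    fix f :: lser assume "f \<in> mps_ord 1"
    then show "\<Phi> f \<in> mps_ord 1"
      unfolding \<Phi>_def power2_eq_square by (intro mps_ord_mult_left mps_ord_diff Asub_ord)
  next
    fix n and f g :: lser assume fg: "f \<in> mps_ord 1" "g \<in> mps_ord 1" "f - g \<in> mps_ord n"
    have "\<Phi> f - \<Phi> g = yi * ((Asub (yy + f) - Asub (yy + g)) - rat_ser (1/2) * ((f - g) * (f + g)))"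
      by (simp add: \<Phi>_def algebra_simps power2_eq_square)
    moreover have "Asub (yy + f) - Asub (yy + g) \<in> mps_ord (Suc n)" using fg by (intro Asub_cong) simp
    moreover have "(f - g) * (f + g) \<in> mps_ord (Suc n)"
      using mps_ord_mult[OF fg(3) mps_ord_add[OF fg(1,2)]] by simp
    ultimately show "\<Phi> f - \<Phi> g \<in> mps_ord (Suc n)"
      by (simp add: mps_ord_mult_left mps_ord_diff)
  qed
  have "yy * (2 * e) = yy * (2 * \<Phi> e)" by (simp add: e)
  also have "\<dots> = (yy * yi) * (2 * Asub (yy + e) - rat_ser (1/2) * (2 * e\<^sup>2))"
    by (simp add: \<Phi>_def algebra_simps)
  also have "\<dots> = 2 * Asub (yy + e) - e\<^sup>2" by (simp add: cmon_mult rat_ser_half)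
  finally have "(yy + e)\<^sup>2 = yy\<^sup>2 + 2 * Asub (yy + e)" by (simp add: power2_eq_square algebra_simps)
  then show ?thesis using e by (intro exI[of _ "yy + e"]) simp
qed

definition Yp :: lser where "Yp = (SOME Y. Y - yy \<in> mps_ord 1 \<and> Y\<^sup>2 = yy\<^sup>2 + 2 * Asub Y)"

lemma Yp_ord: "Yp - yy \<in> mps_ord 1" and Yp_eq: "Yp\<^sup>2 = yy\<^sup>2 + 2 * Asub Yp"
  using someI_ex[OF Yp_exists] by (simp_all add: Yp_def)

text \<open>The derivative with respect to y^2/2, the variable in which Y^2/2 = y^2/2 + A(Y) has
  Lagrange's form.\<close>

definition Dy :: "lser \<Rightarrow> lser" where "Dy f = cmon 0 (-2) * theta_y f"

interpretation Dy: derivation Dy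
  by unfold_locales (simp_all add: Dy_def theta_y.add theta_y.mult algebra_simps)

lemma Dy_ord: "f \<in> mps_ord n \<Longrightarrow> Dy f \<in> mps_ord n"
  by (simp add: Dy_def mps_ord_mult_left theta_y_ord)

lemma Dy_funpow_ord: "f \<in> mps_ord n \<Longrightarrow> (Dy ^^ k) f \<in> mps_ord n"
  by (induction k) (auto intro: Dy_ord)

lemma Dy_euler_commute: "mps_euler (Dy f) = Dy (mps_euler f)"
  by (simp add: Dy_def eul.mult theta_y_euler_commute)

text \<open>Burgers' equation for the flow that scales all \<open>c_a\<close> simultaneously.\<close>
lemma Yp_euler: "mps_euler Yp = Asub Yp * Dy Yp"
proof -
  define s where "s = vv * (1 + Yp)\<^sup>2"
  define c where "c = 2 * (1 + Yp) * Pser' s"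
  have vivv: "vi * vv = 1" by (simp add: cmon_mult)
  \<comment> \<open>Differentiating the equation for Y^2 along y and along the scaling gives two
    linear equations with the same factor \<open>Yp - c\<close>; their right sides are y^2 and
    \<open>Asub Yp\<close>.\<close>
  have 1: "2 * (Yp * theta_y Yp) = 2 * (yy\<^sup>2 + c * theta_y Yp)"
  proof -
    have "theta_y s = vv * (2 * (1 + Yp) * theta_y Yp)"
      by (simp add: s_def theta_y.mult theta_y.power theta_y.add algebra_simps)
    then have "theta_y (Asub Yp) = (vi * vv) * (c * theta_y Yp)"
      unfolding Asub_def s_def[symmetric] c_def by (simp add: theta_y.mult theta_y_Pser algebra_simps)
    then have "theta_y (Asub Yp) = c * theta_y Yp" by (simp add: vivv)
    moreover have "2 * (Yp * theta_y Yp) = theta_y (Yp\<^sup>2)"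
      by (simp add: power2_eq_square theta_y.mult algebra_simps)
    ultimately show ?thesis
      unfolding Yp_eq by (simp add: theta_y.add power2_eq_square theta_y.mult algebra_simps)
  qed
  have 2: "2 * (Yp * mps_euler Yp) = 2 * (Asub Yp + c * mps_euler Yp)"
  proof -
    have "mps_euler s = vv * (2 * (1 + Yp) * mps_euler Yp)"
      by (simp add: s_def eul.mult eul.power eul.add algebra_simps)
    then have "mps_euler (Asub Yp) = Asub Yp + (vi * vv) * (c * mps_euler Yp)"
      unfolding Asub_def s_def[symmetric] c_def by (simp add: eul.mult euler_Pser algebra_simps)
    then have "mps_euler (Asub Yp) = Asub Yp + c * mps_euler Yp" by (simp add: vivv)
    moreover have "2 * (Yp * mps_euler Yp) = mps_euler (Yp\<^sup>2)"
      by (simp add: power2_eq_square eul.mult algebra_simps)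
    ultimately show ?thesis
      unfolding Yp_eq by (simp add: eul.add power2_eq_square eul.mult algebra_simps)
  qed
  have y2: "yy\<^sup>2 * cmon 0 (-2) = 1" by (simp add: cmon_power cmon_mult)
  have "(Yp - c) * (Asub Yp * Dy Yp) = cmon 0 (-2) * Asub Yp * ((Yp - c) * theta_y Yp)"
    by (simp add: Dy_def ac_simps)
  also have "(Yp - c) * theta_y Yp = yy\<^sup>2" using two_cancel[OF 1] by (simp add: algebra_simps)
  also have "cmon 0 (-2) * Asub Yp * yy\<^sup>2 = Asub Yp" using y2 by (simp add: ac_simps)
  also have "Asub Yp = (Yp - c) * mps_euler Yp" using two_cancel[OF 2] by (simp add: algebra_simps)
  finally have eq: "(Yp - c) * (Asub Yp * Dy Yp) = (Yp - c) * mps_euler Yp" .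
  \<comment> \<open>The common factor reduces to y at c = 0, hence is a unit and cancels.\<close>
  have "Yp - c - yy \<in> mps_ord 1"
  proof -
    have "Yp - c - yy = (Yp - yy) - c" by simp
    then show ?thesis
      unfolding c_def by (metis mps_ord_diff Yp_ord mps_ord_mult_left Pser'_ord)
  qed
  moreover have "yy * yi = 1" by (simp add: cmon_mult)
  ultimately obtain u where "(Yp - c) * u = 1" by (rule mps_unit)
  then show ?thesis using arg_cong[OF eq, of "\<lambda>x. u * x"] 
    by (simp flip: mult.assoc) (simp add: mult.commute)
qed

text \<open>The falling factorial \<open>E (E - 1) ... (E - r + 1)\<close>; for the Euler derivation \<open>t d/dt\<close> this is \<open>t^r (d/dt)^r\<close>.\<close>
primrec fall :: "('a::comm_ring_1 \<Rightarrow> 'a) \<Rightarrow> nat \<Rightarrow> 'a \<Rightarrow> 'a" where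
  "fall E 0 f = f"
| "fall E (Suc r) f = E (fall E r f) - of_nat r * fall E r f"

lemma mps_nth_fall_euler: "mps_nth (fall mps_euler r f) m = (\<Prod>i<r. of_nat (mdeg m) - of_nat i) * mps_nth f m"
  by (induction r) (auto simp: algebra_simps)

text \<open>The Euler derivation acts on the coefficient at \<open>m\<close> as the number
  \<open>mdeg m\<close>, so the falling factors multiply to a factorial: the r! of Lagrange's
  formula.\<close>

lemma mps_nth_fall_euler_mdeg:
  "mps_nth (fall mps_euler (mdeg m) f) m = of_nat (fact (mdeg m)) * mps_nth f m"
proof -
  have "(\<Prod>i<n. of_nat n - of_nat i) = (of_nat (fact n) :: 'a::comm_ring_1)" for n
  proof -
    have "(\<Prod>i<n. of_nat n - of_nat i) = (of_nat (\<Prod>i<n. n - i) :: 'a)"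
      by (auto simp: of_nat_prod of_nat_diff intro!: prod.cong)
    also have "(\<Prod>i<n. n - i) = fact n"
      by (simp add: fact_prod_rev atLeast0LessThan)
    finally show ?thesis .
  qed
  then show ?thesis by (simp add: mps_nth_fall_euler)
qed

text \<open>By the two flow equations, E(B^r D F) = r B^r D F + D(B^(r+1) D F) for r > 0; the
  subtraction in \<open>fall\<close> removes exactly the first term.\<close>

lemma lagrange_flow:
  assumes "derivation E" "derivation D" and comm: "\<And>f. E (D f) = D (E f)"
    and B: "E B = B + B * D B" and F: "E F = B * D F"
  shows "fall E (Suc r) F = (D ^^ r) (B ^ Suc r * D F)"
proof (induction r)
  case 0
  then show ?case by (simp add: F)
next
  case (Suc r)
  interpret E: derivation E by fact
  interpret D: derivation D by fact
  have comm': "E ((D ^^ n) f) = (D ^^ n) (E f)" for n f by (induction n) (auto simp: comm)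
  have add': "(D ^^ n) (f + g) = (D ^^ n) f + (D ^^ n) g" for n f g by (induction n) (auto simp: D.add)
  have of_nat': "(D ^^ n) (of_nat k * f) = of_nat k * (D ^^ n) f" for n k f
    by (induction n) (auto simp: D.mult)
  have "E (B ^ Suc r * D F) = of_nat (Suc r) * (B ^ Suc r * D F) + D (B ^ Suc (Suc r) * D F)"
    by (simp only: E.mult E.power D.mult D.power comm B F) (simp add: algebra_simps)
  then show ?case
    by (simp only: fall.simps(2)[of E "Suc r"] Suc comm' add' of_nat') (simp add: funpow_swap1)
qed

section \<open>Translation of the given series into ring operations\<close>

lemma Abs_mps_smul: "Abs_mps (smul f g) = Abs_mps f * Abs_mps g"
  by (rule mps_eqI) (simp add: smul_def mps_nth_mult)

lemma Abs_mps_sconst: "Abs_mps (sconst p) = mps_const p"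
  by (simp add: sconst_def mps_const_def)

lemma Abs_mps_spow: "Abs_mps (spow f r) = Abs_mps f ^ r"
  by (induction r) (simp_all add: Abs_mps_smul Abs_mps_sconst)

lemma Abs_mps_sscale: "Abs_mps (sscale c f) = mps_const c * Abs_mps f"
  by (rule mps_eqI) (simp add: sscale_def)

lemma Abs_mps_ssub: "Abs_mps (ssub f g) = Abs_mps f - Abs_mps g"
  by (rule mps_eqI) (simp add: ssub_def)

lemma Abs_mps_flipS: "Abs_mps (flipS f) = flip (Abs_mps f)"
  by (rule mps_eqI) (simp add: flipS_def flip_def)

lemma Abs_mps_dyS: "Abs_mps (dyS f) = Dy (Abs_mps f)"
  by (rule mps_eqI) (simp add: dyS_def Dy_def theta_y_def dyL_eq cmon_def)

lemma Abs_mps_dyS_funpow: "Abs_mps ((dyS ^^ r) f) = (Dy ^^ r) (Abs_mps f)"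
  by (induction r) (simp_all add: Abs_mps_dyS)

lemma Abs_mps_Aser: "Abs_mps Aser = Asub yy"
proof -
  define p where "p a = mon (int a - 1) 0 * (1 + mon 0 1) ^ (2 * a)" for a
  have "Abs_mps Aser = mps_csum (\<lambda>a. mps_const (p a))"
  proof (rule mps_eqI)
    fix m
    show "mps_nth (Abs_mps Aser) m = mps_nth (mps_csum (\<lambda>a. mps_const (p a))) m"
    \<comment> \<open>Both sides live on the monomials of degree one, and each of these is hit by a
      single index.\<close>
    proof (cases "\<exists>b. m = Poly_Mapping.single b 1")
      case True
      then obtain b where b: "m = Poly_Mapping.single b 1" by blast
      have "Poly_Mapping.single b (1::nat) = Poly_Mapping.single a 1 \<longleftrightarrow> a = b" for a
        by (metis lookup_single_eq lookup_single_not_eq zero_neq_one)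
      then have "mps_nth (Abs_mps Aser) m = p b"
        by (simp add: Aser_def ssum_def sscale_def cvar_def b p_def[symmetric] if_distrib[of "\<lambda>x. _ * x"] conj_commute cong: if_cong)
      then show ?thesis by (simp add: b mps_nth_csum mps_nth_const)
    next
      case False
      have "m - Poly_Mapping.single a 1 \<noteq> 0" if "a \<in> Poly_Mapping.keys m" for a
        using mdeg_diff_single(1)[OF that] False by (metis add.right_neutral)
      then show ?thesis using False
        by (simp add: Aser_def ssum_def sscale_def cvar_def mps_nth_csum mps_nth_const)
    qed
  qed
  also have "mps_const (p a) = vi * (vv * (1 + yy)\<^sup>2) ^ a" for a
  proof -
    have "mps_const (p a) = cmon (int a - 1) 0 * (1 + yy) ^ (2 * a)"
      by (simp add: p_def mps_const_mult mps_const_power mps_const_add cmon_def)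
    also have "cmon (int a - 1) 0 = vi * vv ^ a"
      by (simp add: cmon_power cmon_mult)
    finally show ?thesis by (simp add: power_mult_distrib power_mult mult.assoc)
  qed
  then have "(\<lambda>a. mps_const (p a)) = (\<lambda>a. vi * (vv * (1 + yy)\<^sup>2) ^ a)" by blast
  finally show ?thesis by (simp add: Asub_def Pser_def mps_csum_mult_left)
qed

text \<open>Euler's relation forces homogeneity of degree \<open>r\<close>, because the rational
  coefficients have characteristic 0.\<close>

lemma mps_nth_homogeneous:
  assumes "mps_euler f = of_nat r * (f :: lser)" "mdeg m \<noteq> r"
  shows "mps_nth f m = 0"
proof -
  have "of_nat (mdeg m) * mps_nth f m = of_nat r * mps_nth f m"
    using arg_cong[OF assms(1), of "\<lambda>f. mps_nth f m"] by simp
  moreover have "Poly_Mapping.lookup (of_nat n * p) k = of_nat n * Poly_Mapping.lookup p k" for n and p :: laur and k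
    by (rule additive_of_nat_mult) (simp add: additive_def lookup_add)
  ultimately have "rat_of_nat (mdeg m) * Poly_Mapping.lookup (mps_nth f m) k = of_nat r * Poly_Mapping.lookup (mps_nth f m) k" for k
    by metis
  then have "Poly_Mapping.lookup (mps_nth f m) k = 0" for k
    using assms(2) by (metis mult_cancel_right of_nat_eq_iff)
  then show ?thesis by (intro poly_mapping_eqI) simp
qed

lemma euler_Asub_yy: "mps_euler (Asub yy) = Asub yy"
  by (simp add: Asub_def eul.mult euler_Pser eul.power eul.add)

text \<open>Exchanging one of the \<open>d\<close> factors costs order 2, and the remaining
  \<open>d - 1\<close> factors contribute order 1 each.\<close>

lemma mps_power_diff_ord:
  assumes "f - g \<in> mps_ord 2" "f \<in> mps_ord 1" "g \<in> mps_ord 1"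
  shows "f ^ d - g ^ d \<in> mps_ord (Suc d)"
proof (induction d)
  case (Suc d)
  have "f ^ Suc d - g ^ Suc d = (f - g) * f ^ d + g * (f ^ d - g ^ d)" by (simp add: algebra_simps)
  moreover have "(f - g) * f ^ d \<in> mps_ord (2 + d)" using assms by (intro mps_ord_mult mps_ord_power)
  moreover have "g * (f ^ d - g ^ d) \<in> mps_ord (1 + Suc d)" using assms Suc by (intro mps_ord_mult)
  ultimately show ?case by (simp add: mps_ord_add)
qed auto

lemma theta_y_rat_ser [simp]: "theta_y (rat_ser q) = 0"
  by (auto intro!: mps_eqI poly_mapping_eqI simp: theta_y_def rat_ser_def mps_nth_const lconst_def lookup_single when_def)

text \<open>Lagrange's formula for F = Y + Y^2/2: the flow formula gives r! times the part of F of
  degree r, and lowest-order parts turn it into the r-th summand of T.\<close>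

lemma Tser_eq: "Abs_mps Tser = Yp + Asub Yp"
proof (rule mps_eqI)
  fix m
  define B where "B = Asub Yp"
  \<comment> \<open>This is Y + Y^2/2, by the equation for Y. At c = 0 its derivative
    \<open>Dy F\<close> is 1/y + 1 = (1 + y)/y, the factor \<open>K\<close> in the definition of
    T.\<close>
  define F where "F = Yp + B + rat_ser (1/2) * yy\<^sup>2"
  define K where "K = yi + 1"
  define t where "t r = (if r = 0 then 0 else mps_const (lconst (1 / fact r)) * (Dy ^^ (r - 1)) (K * Asub yy ^ r))" for r
  have BY: "2 * B = Yp\<^sup>2 - yy\<^sup>2" using Yp_eq by (simp add: B_def)
  have EY: "mps_euler Yp = B * Dy Yp" using Yp_euler by (simp add: B_def)
  have B1: "B \<in> mps_ord 1" by (simp add: B_def Asub_ord[simplified])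
  have Dyy2: "Dy (yy\<^sup>2) = 2"
    by (simp add: Dy_def cmon_power cmon_mult mult.left_commute[of _ 2])
  have DB: "Dy B = Yp * Dy Yp - 1"
    using arg_cong[OF BY, of Dy] Dyy2 by - (rule two_cancel, simp add: Dy.diff Dy.mult power2_eq_square algebra_simps)
  have "mps_euler B = B * (Yp * Dy Yp)"
    using arg_cong[OF BY, of mps_euler] EY
    by - (rule two_cancel, simp add: eul.diff eul.mult power2_eq_square algebra_simps)
  moreover have "Yp * Dy Yp = 1 + Dy B" by (simp add: DB)
  ultimately have EB: "mps_euler B = B + B * Dy B" by (simp add: distrib_left)
  have Drc: "Dy (rat_ser q * f) = rat_ser q * Dy f" for q f
    by (simp add: Dy.mult) (simp add: Dy_def)
  have Erc: "mps_euler (rat_ser q * yy\<^sup>2) = 0" for q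
    by (simp add: eul.mult rat_ser_def eul.power)
  have DF: "Dy F = Dy Yp + Dy B + 1"
    using Dyy2 rat_ser_half[of 1] by (simp add: F_def Dy.add Drc)
  have EF: "mps_euler F = B * Dy F"
    unfolding DF by (simp add: F_def eul.add Erc EB EY algebra_simps)
  have DF_K: "Dy F - K \<in> mps_ord 1"
  proof -
    have "Dy yy = yi" by (simp add: Dy_def cmon_mult)
    then have "Dy F - K = Dy (Yp - yy) + Dy B"
      by (simp add: DF K_def Dy.diff)
    then show ?thesis using Dy_ord[OF Yp_ord] Dy_ord[OF B1] by (simp add: mps_ord_add)
  qed
  have F_lead: "mps_nth F m = mps_nth (t (mdeg m)) m" if m: "mdeg m \<noteq> 0"
  proof -
    obtain r where r: "mdeg m = Suc r" using m not0_implies_Suc by blast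
    have "fall mps_euler (Suc r) F = (Dy ^^ r) (B ^ Suc r * Dy F)"
      using derivation_euler Dy.derivation_axioms Dy_euler_commute EB EF
      by (rule lagrange_flow)
    then have "of_nat (fact (mdeg m)) * mps_nth F m = mps_nth ((Dy ^^ r) (B ^ Suc r * Dy F)) m"
      using mps_nth_fall_euler_mdeg[of m F] by (simp add: r)
    \<comment> \<open>The \<open>Suc r\<close> factors \<open>B\<close> already use up the degree of
      \<open>m\<close>, so \<open>B\<close> may be replaced by its linear part
      \<open>Asub yy\<close> and \<open>Dy F\<close> by its constant part \<open>K\<close>.\<close>
    also have "\<dots> = mps_nth ((Dy ^^ r) (K * Asub yy ^ Suc r)) m"
    proof -
      have "B - Asub yy \<in> mps_ord 2" using Asub_cong[OF Yp_ord] by (simp add: B_def numeral_2_eq_2)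
      then have "B ^ Suc r - Asub yy ^ Suc r \<in> mps_ord (Suc (Suc r))"
        by (intro mps_power_diff_ord B1 Asub_ord)
      moreover have "B ^ Suc r * (Dy F - K) \<in> mps_ord (Suc r + 1)"
        by (intro mps_ord_mult mps_ord_power B1 DF_K)
      moreover have "B ^ Suc r * Dy F - K * Asub yy ^ Suc r
          = B ^ Suc r * (Dy F - K) + (B ^ Suc r - Asub yy ^ Suc r) * K"
        by (simp add: algebra_simps)
      ultimately have "B ^ Suc r * Dy F - K * Asub yy ^ Suc r \<in> mps_ord (Suc (Suc r))"
        by (simp add: mps_ord_add mps_ord_mult_right)
      moreover have "(Dy ^^ n) (f - g) = (Dy ^^ n) f - (Dy ^^ n) g" for n f g
        by (induction n) (simp_all add: Dy.diff)
      ultimately have "(Dy ^^ r) (B ^ Suc r * Dy F) - (Dy ^^ r) (K * Asub yy ^ Suc r) \<in> mps_ord (Suc (Suc r))"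
        using Dy_funpow_ord by metis
      from mps_ordD[OF this, of m] show ?thesis by (simp add: r)
    qed
    finally have *: "of_nat (fact (mdeg m)) * mps_nth F m = mps_nth ((Dy ^^ r) (K * Asub yy ^ Suc r)) m" .
    have "lconst (1 / fact (mdeg m)) * of_nat (fact (mdeg m)) = 1"
      by (simp add: lconst_def mult_single flip: single_of_nat zero_prod_def)
    then have "mps_nth F m = lconst (1 / fact (mdeg m)) * (of_nat (fact (mdeg m)) * mps_nth F m)"
      by (simp flip: mult.assoc)
    then show ?thesis unfolding * by (simp add: t_def r)
  qed
  \<comment> \<open>The summand \<open>t r\<close> is homogeneous of degree \<open>r\<close> in the
    c_a, so only one summand meets \<open>m\<close>.\<close>
  have t0: "mps_nth (t r) m = 0" if "r \<noteq> mdeg m" for r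
  proof (cases r)
    case (Suc q)
    have "mps_euler ((Dy ^^ n) f) = (Dy ^^ n) (mps_euler f)" for n f
      by (induction n) (simp_all add: Dy_euler_commute)
    moreover have "(Dy ^^ n) (of_nat k * f) = of_nat k * (Dy ^^ n) f" for n k f
      by (induction n) (auto simp: Dy.mult)
    moreover have "mps_euler (Asub yy ^ n) = of_nat n * Asub yy ^ n" for n
      by (induction n) (simp_all add: eul.mult euler_Asub_yy algebra_simps)
    then have "mps_euler (K * Asub yy ^ r) = of_nat r * (K * Asub yy ^ r)"
      by (simp add: eul.mult K_def eul.add)
    ultimately have "mps_euler ((Dy ^^ q) (K * Asub yy ^ r)) = of_nat r * (Dy ^^ q) (K * Asub yy ^ r)"
      by simp
    then show ?thesis using mps_nth_homogeneous[of "(Dy ^^ q) (K * Asub yy ^ r)" r m] that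
      by (simp add: t_def Suc)
  qed (simp add: t_def)
  let ?G = "\<lambda>r. if r = 0 then (\<lambda>_. 0) else sscale (lconst (1 / fact r))
                        ((dyS ^^ (r - 1)) (smul (sconst (mon 0 (-1) + 1)) (spow Aser r)))"
  have "Abs_mps (?G r) = t r" for r
    by (simp add: t_def zero_mps_def K_def cmon_def mps_const_add Abs_mps_sscale Abs_mps_dyS_funpow Abs_mps_smul Abs_mps_sconst Abs_mps_spow Abs_mps_Aser)
  then have G: "?G r m = mps_nth (t r) m" for r by (metis mps_nth_Abs)
  have "mps_nth (Abs_mps Tser) m = mps_nth yy m + (\<Sum>r\<in>{r. mps_nth (t r) m \<noteq> 0}. mps_nth (t r) m)"
    unfolding Tser_def mps_nth_Abs sadd_def ssum_def G by (simp add: cmon_def mps_const_def sconst_def)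
  also have "(\<Sum>r\<in>{r. mps_nth (t r) m \<noteq> 0}. mps_nth (t r) m) = (\<Sum>r\<in>{mdeg m}. mps_nth (t r) m)"
    by (rule sum.mono_neutral_left) (use t0 in auto)
  also have "mps_nth yy m + (\<Sum>r\<in>{mdeg m}. mps_nth (t r) m) = mps_nth (Yp + B) m"
  \<comment> \<open>In degree 0 only y remains; in positive degree the summand y^2/2 of
    \<open>F\<close> is invisible.\<close>
  proof (cases "mdeg m = 0")
    case True
    then show ?thesis using mps_ordD[OF Yp_ord, of m] mps_ordD[OF B1, of m]
      by (simp add: t_def)
  next
    case False
    then have "m \<noteq> 0" by auto
    then show ?thesis using F_lead[OF False]
      by (simp add: F_def cmon_power) (simp add: cmon_def mps_nth_const rat_ser_def)
  qed
  finally show "mps_nth (Abs_mps Tser) m = mps_nth (Yp + Asub Yp) m" by (simp add: B_def)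
qed

text \<open>The form dlog u is closed.\<close>

lemma dlog_commute:
  assumes "derivation d1" "derivation d2" "d1 (d2 u) = d2 (d1 u)" "u * u' = 1"
  shows "d1 (u' * d2 u) = d2 (u' * d1 u)"
proof -
  interpret d1: derivation d1 by fact
  interpret d2: derivation d2 by fact
  show ?thesis
    by (simp add: d1.mult d2.mult d1.inverse[OF assms(4)] d2.inverse[OF assms(4)] assms(3) algebra_simps)
qed

section \<open>Residues in two coordinates\<close>

text \<open>The four conditions at \<open>0\<close> say that for \<open>c = 0\<close> the coordinates are constant multiples of \<open>v y\<close> and \<open>y\<close>.\<close>
locale residue_coordinates =
  fixes q q' r r' :: lser
  assumes qq': "q * q' = 1" and rr': "r * r' = 1"
    and q0: "mps_nth (theta_v q) 0 = mps_nth q 0" "mps_nth (theta_y q) 0 = mps_nth q 0"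
    and r0: "mps_nth (theta_v r) 0 = 0" "mps_nth (theta_y r) 0 = mps_nth r 0"
begin

definition \<omega> :: lser where
  "\<omega> = (q' * theta_v q) * (r' * theta_y r) - (q' * theta_y q) * (r' * theta_v r)"

definition W :: "int \<Rightarrow> int \<Rightarrow> lser" where "W i j = upow q q' i * upow r r' j"

lemma W_0_0 [simp]: "W 0 0 = 1"
  by (simp add: W_def)

lemma W_mult: "W i j * W k l = W (i + k) (j + l)"
  by (simp add: W_def upow_add[OF qq'] upow_add[OF rr'] ac_simps)

lemma q_eq_W: "q = W 1 0"
  by (simp add: W_def)

lemma W_power: "W i j ^ n = W (int n * i) (int n * j)"
  by (induction n) (simp_all add: W_mult algebra_simps)

lemma dlog_W:
  assumes "derivation d"
  shows "d (W i j) = W i j * (of_int i * (q' * d q) + of_int j * (r' * d r))"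
proof -
  interpret derivation d by fact
  show ?thesis by (simp add: W_def mult upow[OF qq'] upow[OF rr'] algebra_simps)
qed

lemmas dv = theta_v.derivation_axioms and dy = theta_y.derivation_axioms

text \<open>The form q^i r^j dlog q \<and> dlog r is d(q^i r^j dlog r)/i, or -d(q^i r^j dlog q)/j,
  and exact forms have no residue.\<close>

lemma CT_W_omega_nonzero:
  assumes "i \<noteq> 0 \<or> j \<noteq> 0"
  shows "CT (W i j * \<omega>) m = 0"
proof -
  note closed = dlog_commute[OF dv dy theta_v_theta_y_commute qq'] dlog_commute[OF dv dy theta_v_theta_y_commute rr']
  define qv qy rv ry where defs: "qv = q' * theta_v q" "qy = q' * theta_y q" "rv = r' * theta_v r" "ry = r' * theta_y r"
  have c: "theta_v qy = theta_y qv" "theta_v ry = theta_y rv" using closed by (simp_all add: defs)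
  note dW = dlog_W[OF dv, of i j, folded defs] dlog_W[OF dy, of i j, folded defs]
  have "of_int i * (W i j * \<omega>) = theta_v (W i j * ry) - theta_y (W i j * rv)"
    unfolding \<omega>_def defs[symmetric]
    by (simp add: theta_v.mult theta_y.mult dW c algebra_simps)
  from arg_cong[OF this, of "\<lambda>f. CT f m"] have "i \<noteq> 0 \<Longrightarrow> ?thesis"
    by (simp add: CT_of_int_mult CT_diff)
  moreover have "of_int j * (W i j * \<omega>) = theta_y (W i j * qv) - theta_v (W i j * qy)"
    unfolding \<omega>_def defs[symmetric]
    by (simp add: theta_v.mult theta_y.mult dW c algebra_simps)
  from arg_cong[OF this, of "\<lambda>f. CT f m"] have "j \<noteq> 0 \<Longrightarrow> ?thesis"
    by (simp add: CT_of_int_mult CT_diff)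
  ultimately show ?thesis using assms by blast
qed

text \<open>The Euler derivative of dlog q \<and> dlog r is exact, which kills the residue in
  positive c-degree. At c = 0 the form is dlog(v y) \<and> dlog y, with residue 1.\<close>

lemma CT_omega: "CT \<omega> m = (if m = 0 then 1 else 0)"
proof (cases "m = 0")
  case True
  have "mps_nth q' 0 * mps_nth q 0 = 1" "mps_nth r' 0 * mps_nth r 0 = 1"
    using arg_cong[OF qq', of "\<lambda>f. mps_nth f 0"] arg_cong[OF rr', of "\<lambda>f. mps_nth f 0"]
    by (simp_all add: mps_nth_mult_0 mps_nth_1 mult.commute)
  then have "mps_nth \<omega> 0 = 1"
    by (simp add: \<omega>_def mps_nth_mult_0 q0 r0)
  then show ?thesis using True by (simp add: CT_def lookup_one zero_prod_def)
next
  case False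
  note de = eul.derivation_axioms
  define qv qy qe rv ry re where defs: "qv = q' * theta_v q" "qy = q' * theta_y q" "qe = q' * mps_euler q"
    "rv = r' * theta_v r" "ry = r' * theta_y r" "re = r' * mps_euler r"
  have c: "theta_v qy = theta_y qv" "theta_v ry = theta_y rv" "mps_euler qv = theta_v qe" "mps_euler qy = theta_y qe"
      "mps_euler rv = theta_v re" "mps_euler ry = theta_y re"
    unfolding defs
    by (rule dlog_commute[OF dv dy theta_v_theta_y_commute qq'] dlog_commute[OF dv dy theta_v_theta_y_commute rr']
          dlog_commute[OF de dv theta_v_euler_commute[symmetric] qq'] dlog_commute[OF de dy theta_y_euler_commute[symmetric] qq']
          dlog_commute[OF de dv theta_v_euler_commute[symmetric] rr'] dlog_commute[OF de dy theta_y_euler_commute[symmetric] rr'])+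
  have "mps_euler \<omega> = theta_v (qe * ry) - theta_y (qe * rv) + theta_y (re * qv) - theta_v (re * qy)"
    unfolding \<omega>_def defs(1-2,4-5)[symmetric]
    by (simp add: eul.diff eul.mult theta_v.mult theta_y.mult c algebra_simps)
  from arg_cong[OF this, of "\<lambda>f. CT f m"] have "of_nat (mdeg m) * CT \<omega> m = 0"
    by (simp add: CT_euler CT_diff CT_add)
  then show ?thesis using False by (simp add: mdeg_eq_0_iff)
qed

lemma CT_W_omega: "CT (W i j * \<omega>) m = (if i = 0 \<and> j = 0 \<and> m = 0 then 1 else 0)"
  using CT_W_omega_nonzero[of i j m] CT_omega[of m] by (cases "i = 0 \<and> j = 0") auto

lemma CT_sum: "CT (sum f A) m = (\<Sum>x\<in>A. CT (f x) m)"
  by (induction A rule: infinite_finite_induct) (auto simp: CT_add)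

text \<open>Of the binomial expansion only the term in \<open>r ^ n\<close> cancels
  \<open>r' ^ n\<close>.\<close>

lemma CT_binomial:
  "CT (W i 0 * ((1 + of_int \<sigma> * r) ^ k * r' ^ n) * \<omega>) m = (if i = 0 \<and> m = 0 then of_int (\<sigma> ^ n) * of_nat (k choose n) else 0)"
proof -
  have "W i 0 * ((1 + of_int \<sigma> * r) ^ k * r' ^ n) * \<omega>
      = (\<Sum>l\<le>k. of_int (int (k choose l) * \<sigma> ^ l) * (W i (int l - int n) * \<omega>))"
  proof -
    have "(1 + of_int \<sigma> * r) ^ k = (\<Sum>l\<le>k. of_nat (k choose l) * (of_int \<sigma> * r) ^ l)"
      using binomial_ring[of "of_int \<sigma> * r" 1 k] by (simp add: add.commute)
    moreover have "W i 0 * (of_nat (k choose l) * (of_int \<sigma> * r) ^ l * r' ^ n) * \<omega>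
      = of_int (int (k choose l) * \<sigma> ^ l) * (W i (int l - int n) * \<omega>)" for l
    proof -
      have "r ^ l = W 0 (int l)" "r' ^ n = W 0 (- int n)" by (simp_all add: W_def)
      moreover have "W i (int l - int n) = W i 0 * W 0 (int l) * W 0 (- int n)" by (simp add: W_mult)
      ultimately show ?thesis by (simp add: power_mult_distrib ac_simps)
    qed
    ultimately show ?thesis by (simp add: sum_distrib_left sum_distrib_right)
  qed
  then have "CT (W i 0 * ((1 + of_int \<sigma> * r) ^ k * r' ^ n) * \<omega>) m
      = (\<Sum>l\<le>k. of_int (int (k choose l) * \<sigma> ^ l) * (if i = 0 \<and> l = n \<and> m = 0 then 1 else 0))"
    by (simp only: CT_sum CT_of_int_mult CT_W_omega) simp
  also have "\<dots> = (\<Sum>l\<le>k. if l = n then (if i = 0 \<and> m = 0 then of_int (\<sigma> ^ n) * of_nat (k choose n) else 0) else 0)"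
    by (rule sum.cong) auto
  also have "\<dots> = (if i = 0 \<and> m = 0 then of_int (\<sigma> ^ n) * of_nat (k choose n) else 0)"
    by (auto simp: binomial_eq_0)
  finally show ?thesis .
qed

text \<open>Up to \<open>c\<close>-degree \<open>n\<close>, the elements of \<open>nullord n\<close> behave like functions invariant under \<open>r \<mapsto> 1/r\<close>:
  multiplied by an anti-invariant Laurent polynomial they have no residue.\<close>
definition nullord :: "nat \<Rightarrow> lser set" where
  "nullord n = {X. \<forall>i e m. mdeg m < n \<longrightarrow> CT (X * ((W i e - W i (- e)) * \<omega>)) m = 0}"

lemma nullord_1: "1 \<in> nullord n"
  by (simp add: nullord_def left_diff_distrib CT_diff CT_W_omega)

lemma nullord_add: "X \<in> nullord n \<Longrightarrow> Y \<in> nullord n \<Longrightarrow> X + Y \<in> nullord n"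
  and nullord_diff: "X \<in> nullord n \<Longrightarrow> Y \<in> nullord n \<Longrightarrow> X - Y \<in> nullord n"
  by (simp_all add: nullord_def distrib_right left_diff_distrib[of X] CT_add CT_diff)

lemma nullord_zero: "0 \<in> nullord n"
  by (simp add: nullord_def)

lemma nullord_sum: "(\<And>x. x \<in> A \<Longrightarrow> f x \<in> nullord n) \<Longrightarrow> sum f A \<in> nullord n"
  by (induction A rule: infinite_finite_induct) (auto simp: nullord_zero nullord_add)

lemma nullord_of_int: "X \<in> nullord n \<Longrightarrow> of_int k * X \<in> nullord n"
  by (simp add: nullord_def mult.assoc CT_of_int_mult)

text \<open>The factor \<open>c_a\<close> uses up one degree; this gain drives the induction that
  handles the inverse of \<Psi>.\<close>

lemma nullord_csum:
  assumes "\<And>a. F a \<in> nullord n"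
  shows "mps_csum F \<in> nullord (Suc n)"
  unfolding nullord_def
proof (intro CollectI allI impI)
  fix i e and m :: "nat \<Rightarrow>\<^sub>0 nat" assume m: "mdeg m < Suc n"
  have "CT (F a * ((W i e - W i (- e)) * \<omega>)) (m - Poly_Mapping.single a 1) = 0"
    if "a \<in> Poly_Mapping.keys m" for a
    using mdeg_diff_single(2)[OF that] m assms[of a] unfolding nullord_def by simp
  then show "CT (mps_csum F * ((W i e - W i (- e)) * \<omega>)) m = 0"
    by (simp add: CT_csum flip: mps_csum_mult)
qed

lemma nullord_mono: "X \<in> nullord (Suc n) \<Longrightarrow> X \<in> nullord n"
  by (auto simp: nullord_def)

text \<open>The factor r + k + 1/r is symmetric, so it maps each antisymmetric pair to a combination
  of the pairs for \<open>e + 1\<close>, \<open>e\<close> and \<open>e - 1\<close>.\<close>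

lemma nullord_mult:
  assumes s: "4 * s = q * (r + of_int k + r')" and X: "X \<in> nullord n"
  shows "s * X \<in> nullord n"
  unfolding nullord_def
proof (intro CollectI allI impI)
  fix i e and m :: "nat \<Rightarrow>\<^sub>0 nat" assume m: "mdeg m < n"
  let ?V = "\<lambda>e. (W (i + 1) e - W (i + 1) (- e)) * \<omega>"
  have "4 * (s * X * ((W i e - W i (- e)) * \<omega>)) = X * ((q * (r + of_int k + r')) * (W i e - W i (- e)) * \<omega>)"
    unfolding s[symmetric] by (simp only: ac_simps)
  also have "(q * (r + of_int k + r')) * (W i e - W i (- e)) * \<omega>
     = ?V (e + 1) + of_int k * ?V e + ?V (e - 1)"
  proof -
    have "q * r = W 1 1" "q * r' = W 1 (-1)" by (simp_all add: W_def)
    then have "q * (r + of_int k + r') = W 1 1 + of_int k * W 1 0 + W 1 (- 1)"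
      by (simp add: q_eq_W[symmetric] algebra_simps)
    then show ?thesis
      by (simp add: algebra_simps W_mult)
  qed
  finally have "4 * (s * X * ((W i e - W i (- e)) * \<omega>)) = X * ?V (e + 1) + of_int k * (X * ?V e) + X * ?V (e - 1)"
    by (simp add: algebra_simps)
  moreover have "CT (X * ?V e') m = 0" for e' using X m unfolding nullord_def by blast
  ultimately have "CT (4 * (s * X * ((W i e - W i (- e)) * \<omega>))) m = 0"
    by (simp only: CT_add CT_of_int_mult)
  then show "CT (s * X * ((W i e - W i (- e)) * \<omega>)) m = 0"
    using CT_of_int_mult[of 4 _ m] by simp
qed

lemma nullord_power_mult:
  assumes "4 * s = q * (r + of_int k + r')" "X \<in> nullord n"
  shows "s ^ l * X \<in> nullord n"
  by (induction l) (use nullord_mult[OF assms(1)] assms(2) in \<open>auto simp: mult.assoc\<close>)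

end

section \<open>The Jacobian of the new coordinates\<close>

text \<open>The hypotheses are the v- and y-derivatives of \<phi>(s) - 2 v P = v (y^2 - 1) and its
  analogue for t, with \<open>a\<close> = \<phi>'(s) and \<open>b\<close> = \<phi>'(t). The large
  bracket is the Jacobian of q and \<rho>, cleared of the denominator (P + M)^2.\<close>

lemma jacobian_identity:
  fixes v y2 P M Pv Py Mv My a b :: "'a::comm_ring_1"
  assumes "a * (P\<^sup>2 + 2 * P * Pv) - 2 * P - 2 * Pv = y2 - 1" "(a * P - 1) * Py = y2"
    and "b * (M\<^sup>2 + 2 * M * Mv) - 2 * M - 2 * Mv = y2 - 1" "(b * M - 1) * My = y2"
  shows "(a * P - 1) * (b * M - 1) * ((v * (P\<^sup>2 - M\<^sup>2) + v * (2 * P * Pv - 2 * M * Mv)) * (2 * M * Py - 2 * P * My)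
      - v * (2 * P * Py - 2 * M * My) * (2 * M * Pv - 2 * P * Mv)) = - 2 * v * y2 * (P - M)\<^sup>2 * (P + M)"
proof -
  define \<alpha> \<beta> where "\<alpha> = a * P - 1" "\<beta> = b * M - 1"
  have Pv: "2 * (\<alpha> * Pv) = y2 - 1 + P - \<alpha> * P"
    using assms(1) by (simp add: \<alpha>_\<beta>_def algebra_simps power2_eq_square)
  have Mv: "2 * (\<beta> * Mv) = y2 - 1 + M - \<beta> * M"
    using assms(3) by (simp add: \<alpha>_\<beta>_def algebra_simps power2_eq_square)
  \<comment> \<open>After multiplication by \<open>\<alpha> * \<beta>\<close> every derivative
    occurs in a product that the hypotheses evaluate.\<close>
  have "\<alpha> * \<beta> * ((v * (P\<^sup>2 - M\<^sup>2) + v * (2 * P * Pv - 2 * M * Mv)) * (2 * M * Py - 2 * P * My)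
      - v * (2 * P * Py - 2 * M * My) * (2 * M * Pv - 2 * P * Mv))
    = 2 * v * (P\<^sup>2 - M\<^sup>2) * (\<beta> * M * (\<alpha> * Py) - \<alpha> * P * (\<beta> * My)
        + (\<alpha> * Py) * (2 * (\<beta> * Mv)) - (2 * (\<alpha> * Pv)) * (\<beta> * My))"
    by (simp add: algebra_simps power2_eq_square)
  also have "\<dots> = 2 * v * (P\<^sup>2 - M\<^sup>2) * (\<beta> * M * y2 - \<alpha> * P * y2
        + y2 * (y2 - 1 + M - \<beta> * M) - (y2 - 1 + P - \<alpha> * P) * y2)"
    using assms(2,4) by (simp only: Pv Mv flip: \<alpha>_\<beta>_def)
  also have "\<dots> = - 2 * v * y2 * (P - M)\<^sup>2 * (P + M)"
    by (simp add: algebra_simps power2_eq_square)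
  finally show ?thesis by (simp only: \<alpha>_\<beta>_def)
qed

section \<open>The change of coordinates\<close>

lemma flip_of_nat [simp]: "flip (of_nat n) = of_nat n"
  using flip_diff[of 0 0] by (induction n) simp_all

lemma flip_numeral [simp]: "flip (numeral n) = numeral n"
  using flip_of_nat[of "numeral n"] by simp

lemma Asub_flip: "flip (Asub Y) = Asub (flip Y)"
  by (simp add: Asub_def Pser_def flip_csum flip_cmon)

definition Pp :: lser where "Pp = 1 + Yp"
definition Pm :: lser where "Pm = 1 + flip Yp"
definition sp :: lser where "sp = vv * Pp\<^sup>2"
definition sm :: lser where "sm = vv * Pm\<^sup>2"

lemma sm_flip: "sm = flip sp" and Pm_flip: "Pm = flip Pp"
  by (simp_all add: sp_def sm_def Pp_def Pm_def flip_cmon)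

lemma vv_vi: "vv * vi = 1" by (simp add: cmon_mult)

lemma vv_cancel: "vv * f = vv * g \<Longrightarrow> f = g"
proof -
  assume "vv * f = vv * g"
  then have "vi * vv * f = vi * vv * g" by (simp add: mult.assoc)
  then show ?thesis using vv_vi by (simp add: mult.commute)
qed

text \<open>The equation for Y^2 multiplied by v; expanding the square yields \<phi>(s) - 2 v P = v
  (y^2 - 1).\<close>

lemma phi_Pp: "vv * (Pp - 1)\<^sup>2 = vv * yy\<^sup>2 + 2 * Pser sp"
proof -
  have "vv * Yp\<^sup>2 = vv * yy\<^sup>2 + 2 * ((vv * vi) * Pser sp)"
    by (simp add: Yp_eq Asub_def sp_def Pp_def algebra_simps)
  then show ?thesis by (simp add: Pp_def vv_vi)
qed

text \<open>The value \<phi>'(s); \<open>am\<close> is \<phi>'(t).\<close>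

definition ap :: lser where "ap = 1 - 2 * Pser' sp"
definition am :: lser where "am = 1 - 2 * Pser' sm"

lemma am_flip: "am = flip ap"
  by (simp add: ap_def am_def sm_flip Pser'_def flip_csum)

text \<open>These are the hypotheses of \<open>jacobian_identity\<close>, obtained by applying
  \<open>theta_v\<close> and \<open>theta_y\<close> to \<open>phi_Pp\<close>.\<close>

lemma deriv_Pp:
  shows "ap * (Pp\<^sup>2 + 2 * Pp * theta_v Pp) - 2 * Pp - 2 * theta_v Pp = yy\<^sup>2 - 1"
    and "(ap * Pp - 1) * theta_y Pp = yy\<^sup>2"
proof -
  have "theta_v sp = vv * (Pp\<^sup>2 + 2 * Pp * theta_v Pp)"
    by (simp add: sp_def theta_v.mult power2_eq_square algebra_simps)
  then have "vv * (Pp - 1)\<^sup>2 + vv * (2 * ((Pp - 1) * theta_v Pp)) = vv * yy\<^sup>2 + vv * (2 * (Pser' sp * (Pp\<^sup>2 + 2 * Pp * theta_v Pp)))"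
    using arg_cong[OF phi_Pp, of theta_v] 
    by (simp add: theta_v.mult theta_v.add theta_v.diff theta_v_Pser power2_eq_square algebra_simps)
  then have "(Pp - 1)\<^sup>2 + 2 * ((Pp - 1) * theta_v Pp) = yy\<^sup>2 + 2 * (Pser' sp * (Pp\<^sup>2 + 2 * Pp * theta_v Pp))"
    by - (rule vv_cancel, simp only: distrib_left)
  then show "ap * (Pp\<^sup>2 + 2 * Pp * theta_v Pp) - 2 * Pp - 2 * theta_v Pp = yy\<^sup>2 - 1"
    by (simp add: ap_def algebra_simps power2_eq_square)
  have "theta_y sp = vv * (2 * Pp * theta_y Pp)"
    by (simp add: sp_def theta_y.mult power2_eq_square algebra_simps)
  then have "2 * (vv * ((Pp - 1) * theta_y Pp)) = 2 * (vv * (yy\<^sup>2 + 2 * (Pser' sp * Pp * theta_y Pp)))"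
    using arg_cong[OF phi_Pp, of theta_y] 
    by (simp add: theta_y.mult theta_y.add theta_y.diff theta_y_Pser power2_eq_square algebra_simps)
  then have "(Pp - 1) * theta_y Pp = yy\<^sup>2 + 2 * (Pser' sp * Pp * theta_y Pp)"
    by - (rule vv_cancel, rule two_cancel)
  then show "(ap * Pp - 1) * theta_y Pp = yy\<^sup>2"
    by (simp add: ap_def algebra_simps)
qed

lemma deriv_Pm:
  shows "am * (Pm\<^sup>2 + 2 * Pm * theta_v Pm) - 2 * Pm - 2 * theta_v Pm = yy\<^sup>2 - 1"
    and "(am * Pm - 1) * theta_y Pm = yy\<^sup>2"
  using deriv_Pp[THEN arg_cong[where f = flip]]
  by (simp_all add: am_flip Pm_flip theta_v_flip theta_y_flip flip_cmon power2_eq_square)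

lemma phi_Pm: "vv * (Pm - 1)\<^sup>2 = vv * yy\<^sup>2 + 2 * Pser sm"
  using phi_Pp[THEN arg_cong[where f = flip]]
  by (simp add: Pm_flip sm_flip flip_cmon Pser_def flip_csum power2_eq_square)

definition qq :: lser where "qq = vv * (Pp\<^sup>2 - Pm\<^sup>2)"

lemma qq_eq: "qq = sp - sm"
  by (simp add: qq_def sp_def sm_def algebra_simps)

text \<open>Since 2 A(Y) = Y^2 - y^2, twice T is (1 + Y)^2 - 1 - y^2, and the last two terms are
  even in y.\<close>

lemma Sser_eq: "4 * Abs_mps Sser = Pp\<^sup>2 - Pm\<^sup>2"
proof -
  define Z where "Z = Abs_mps Tser - flip (Abs_mps Tser)"
  have "Abs_mps Sser = rat_ser (1/2) * Z"
    by (simp add: Sser_def Abs_mps_sscale Abs_mps_ssub Abs_mps_flipS rat_ser_def Z_def)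
  then have "2 * Abs_mps Sser = rat_ser (1/2) * (2 * Z)" by (simp only: mult.left_commute)
  then have *: "2 * Abs_mps Sser = Z" by (simp only: rat_ser_half)
  have "4 * Abs_mps Sser = 2 * (2 * Abs_mps Sser)" by simp
  also have "\<dots> = 2 * Z" by (simp only: *)
  also have "\<dots> = 2 * (Yp + Asub Yp - (flip Yp + Asub (flip Yp)))"
    by (simp add: Z_def Tser_eq Asub_flip)
  also have "\<dots> = Pp\<^sup>2 - Pm\<^sup>2"
  proof -
    have "(flip Yp)\<^sup>2 = yy\<^sup>2 + 2 * Asub (flip Yp)"
      using arg_cong[OF Yp_eq, of flip] by (simp add: Asub_flip flip_cmon)
    then have "2 * Asub Yp - 2 * Asub (flip Yp) = Yp\<^sup>2 - (flip Yp)\<^sup>2" using Yp_eq by simp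
    moreover have "2 * (Yp + Asub Yp - (flip Yp + Asub (flip Yp))) = 2 * Yp - 2 * flip Yp + (2 * Asub Yp - 2 * Asub (flip Yp))"
      by (simp add: algebra_simps)
    ultimately show ?thesis by (simp add: Pp_def Pm_def power2_eq_square algebra_simps)
  qed
  finally show ?thesis .
qed

lemma Pp_ord: "Pp - (1 + yy) \<in> mps_ord 1"
  using Yp_ord by (simp add: Pp_def algebra_simps)

lemma Pm_ord: "Pm - (1 - yy) \<in> mps_ord 1"
proof -
  have "flip (Pp - (1 + yy)) = Pm - (1 - yy)" by (simp add: Pm_flip flip_cmon)
  then show ?thesis using flip_ord[OF Pp_ord] by metis
qed

text \<open>At c = 0 the sum P + M is 2, and the difference P - M is 2 y; both are invertible
  Laurent polynomials.\<close>

lemma sum_unit: "\<exists>li. (Pp + Pm) * li = 1"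
proof -
  have "(Pp + Pm) - 2 = (Pp - (1 + yy)) + (Pm - (1 - yy))" by simp
  then have "(Pp + Pm) - 2 \<in> mps_ord 1" using Pp_ord Pm_ord mps_ord_add by metis
  moreover have "2 * rat_ser (1/2) = 1" using rat_ser_half[of 1] by (simp add: mult.commute)
  ultimately show ?thesis using mps_unit by metis
qed

lemma diff_unit: "\<exists>ki. (Pp - Pm) * ki = 1"
proof -
  have "(Pp - Pm) - 2 * yy = (Pp - (1 + yy)) - (Pm - (1 - yy))" by simp
  then have "(Pp - Pm) - 2 * yy \<in> mps_ord 1" using Pp_ord Pm_ord mps_ord_diff by metis
  moreover have "2 * yy * (rat_ser (1/2) * yi) = rat_ser (1/2) * (2 * (yy * yi))"
    by (simp only: ac_simps)
  then have "2 * yy * (rat_ser (1/2) * yi) = 1" by (simp only: rat_ser_half) (simp add: cmon_mult)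
  ultimately show ?thesis using mps_unit by metis
qed

section \<open>The coordinates q and \<rho>, written \<open>qq\<close> and \<open>rr\<close>\<close>

definition li :: lser where "li = (SOME x. (Pp + Pm) * x = 1)"
definition ki :: lser where "ki = (SOME x. (Pp - Pm) * x = 1)"

lemma li: "(Pp + Pm) * li = 1" and ki: "(Pp - Pm) * ki = 1"
  unfolding li_def ki_def by (rule someI_ex[OF sum_unit] someI_ex[OF diff_unit])+

definition qi :: lser where "qi = vi * ki * li"
definition rr :: lser where "rr = (Pp - Pm) * li"
definition ri :: lser where "ri = (Pp + Pm) * ki"

lemma qq_qi: "qq * qi = 1"
proof -
  have "qq * qi = (vv * vi) * ((Pp - Pm) * ki) * ((Pp + Pm) * li)"
    by (simp add: qq_def qi_def algebra_simps power2_eq_square)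
  then show ?thesis by (simp add: vv_vi li ki)
qed

lemma rr_ri: "rr * ri = 1"
proof -
  have "rr * ri = ((Pp - Pm) * ki) * ((Pp + Pm) * li)"
    by (simp add: rr_def ri_def ac_simps)
  then show ?thesis by (simp add: li ki)
qed

lemma rr_mult: "rr * (Pp + Pm) = Pp - Pm"
proof -
  have "rr * (Pp + Pm) = (Pp - Pm) * ((Pp + Pm) * li)" by (simp only: rr_def ac_simps)
  then show ?thesis by (simp add: li)
qed

lemma nth_0_of_ord: "f - g \<in> mps_ord 1 \<Longrightarrow> mps_nth f 0 = mps_nth g 0"
  using mps_ordD[of "f - g" 1 0] by simp

lemma nth_0_Pp: "mps_nth Pp 0 = 1 + mon 0 1"
  and nth_0_Pm: "mps_nth Pm 0 = 1 - mon 0 1"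
  using nth_0_of_ord[OF Pp_ord] nth_0_of_ord[OF Pm_ord] by (simp_all add: mps_nth_1 cmon_def mps_nth_const)

lemma nth_0_qq: "mps_nth qq 0 = 4 * mon 1 1"
  by (simp add: qq_def power2_eq_square mps_nth_mult_0 nth_0_Pp nth_0_Pm cmon_def mps_nth_const algebra_simps mon_mult)

lemma lconst_half: "lconst (1/2) * (2 * p) = p"
  using mult_single[of "(0::int,0::int)" "1/2::rat" "(0,0)" 2]
  by (simp add: lconst_def flip: mult.assoc single_numeral zero_prod_def)

lemma nth_0_rr: "mps_nth rr 0 = mon 0 1"
proof -
  have "2 * mps_nth rr 0 = 2 * mon 0 1"
    using arg_cong[OF rr_mult, of "\<lambda>f. mps_nth f 0"] 
    by (simp add: mps_nth_mult_0 nth_0_Pp nth_0_Pm algebra_simps)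
  then show ?thesis by (metis lconst_half)
qed

text \<open>At c = 0, P = 1 + y and M = 1 - y, hence q = 4 v y and \<rho> = y.\<close>

interpretation coords: residue_coordinates qq qi rr ri
proof
  have four: "4 * mon 1 1 = Poly_Mapping.single (1, 1) 4"
    by (simp add: mon_def mult_single flip: single_numeral zero_prod_def)
  show "mps_nth (theta_v qq) 0 = mps_nth qq 0" "mps_nth (theta_y qq) 0 = mps_nth qq 0"
    unfolding theta_v_def theta_y_def mps_nth_map nth_0_qq four by simp_all
  show "mps_nth (theta_v rr) 0 = 0" "mps_nth (theta_y rr) 0 = mps_nth rr 0"
    unfolding theta_v_def theta_y_def mps_nth_map nth_0_rr by (simp_all add: mon_def)
qed (fact qq_qi rr_ri)+

abbreviation om :: lser where "om \<equiv> coords.\<omega>"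

text \<open>\<open>jacobian_identity\<close> divided by (P - M)^2 (P + M), using \<rho> (P + M) = P
  - M.\<close>

lemma key_identity: "2 * (vv * yy\<^sup>2) = - ((ap * Pp - 1) * (am * Pm - 1) * (qq * ki) * om)"
proof -
  define \<alpha>\<beta> where "\<alpha>\<beta> = (ap * Pp - 1) * (am * Pm - 1)"
  have dq: "theta_v qq = vv * (Pp\<^sup>2 - Pm\<^sup>2) + vv * (2 * Pp * theta_v Pp - 2 * Pm * theta_v Pm)"
    "theta_y qq = vv * (2 * Pp * theta_y Pp - 2 * Pm * theta_y Pm)"
    by (simp_all add: qq_def theta_v.mult theta_y.mult theta_v.diff theta_y.diff power2_eq_square algebra_simps)
  have dr: "(Pp + Pm)\<^sup>2 * d rr = 2 * Pm * d Pp - 2 * Pp * d Pm" if "derivation d" for d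
  proof -
    interpret derivation d by fact
    have "d rr * (Pp + Pm) + rr * (d Pp + d Pm) = d Pp - d Pm"
      using arg_cong[OF rr_mult, of d] by (simp add: mult add diff)
    then have "d rr * (Pp + Pm) = (d Pp - d Pm) - rr * (d Pp + d Pm)"
      by (simp add: eq_diff_eq)
    then have "(Pp + Pm) * (d rr * (Pp + Pm)) = (Pp + Pm) * ((d Pp - d Pm) - rr * (d Pp + d Pm))"
      by (simp only:)
    also have "\<dots> = (Pp + Pm) * (d Pp - d Pm) - (rr * (Pp + Pm)) * (d Pp + d Pm)"
      by (simp add: algebra_simps)
    finally have "(Pp + Pm) * (d rr * (Pp + Pm)) = \<dots>" .
    then show ?thesis by (simp add: rr_mult) (simp add: algebra_simps power2_eq_square)
  qed
  have om: "qq * rr * om = theta_v qq * theta_y rr - theta_y qq * theta_v rr"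
  proof -
    have "qq * rr * om = (qq * qi) * (rr * ri) * (theta_v qq * theta_y rr - theta_y qq * theta_v rr)"
      by (simp add: coords.\<omega>_def algebra_simps)
    then show ?thesis by (simp add: qq_qi rr_ri)
  qed
  have "\<alpha>\<beta> * ((Pp + Pm)\<^sup>2 * (qq * rr * om)) =
     \<alpha>\<beta> * (theta_v qq * ((Pp + Pm)\<^sup>2 * theta_y rr) - theta_y qq * ((Pp + Pm)\<^sup>2 * theta_v rr))"
    by (simp only: om) (simp add: algebra_simps)
  also have "\<dots> = - 2 * vv * yy\<^sup>2 * (Pp - Pm)\<^sup>2 * (Pp + Pm)"
    unfolding dr[OF coords.dv] dr[OF coords.dy] dq \<alpha>\<beta>_def
    using jacobian_identity[OF deriv_Pp deriv_Pm, of vv] by (simp only: mult.assoc)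
  finally have *: "\<alpha>\<beta> * ((Pp + Pm)\<^sup>2 * (qq * rr * om)) = - 2 * vv * yy\<^sup>2 * (Pp - Pm)\<^sup>2 * (Pp + Pm)" .
  have "\<alpha>\<beta> * (qq * ki) * om = \<alpha>\<beta> * (qq * ki) * om * ((rr * (Pp + Pm)) * ki) * ((Pp + Pm) * li)"
    by (simp add: rr_mult li ki)
  also have "\<dots> = (\<alpha>\<beta> * ((Pp + Pm)\<^sup>2 * (qq * rr * om))) * (ki\<^sup>2 * li)"
    by (simp only: power2_eq_square ac_simps)
  also have "\<dots> = - (2 * (vv * yy\<^sup>2) * ((Pp - Pm) * ki)\<^sup>2 * ((Pp + Pm) * li))"
    unfolding * by (simp add: power2_eq_square ac_simps)
  finally show ?thesis by (simp add: li ki \<alpha>\<beta>_def)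
qed

text \<open>The divided difference of P at s and t, written as a sum of monomials in s and t so that
  invariance under \<rho> -> 1/\<rho> can be read off termwise.\<close>

definition eta :: lser where "eta = mps_csum (\<lambda>c. \<Sum>i<c. sm ^ (c - Suc i) * sp ^ i)"

lemma eta_eq: "qq * eta = Pser sp - Pser sm"
  unfolding eta_def Pser_def qq_eq
  by (simp add: power_diff_sumr2 flip: mps_csum_mult_left mps_csum_diff)

text \<open>Subtracting the equations for s and t gives 2 v (P - M) = q \<Psi>, while q = v (P -
  M)(P + M).\<close>

lemma two_li: "2 * li = 1 - 2 * eta"
proof -
  have "vv * (2 * (Pp - Pm)) = qq - 2 * (qq * eta)"
  proof -
    have "vv * (Pp - 1)\<^sup>2 - vv * (Pm - 1)\<^sup>2 = 2 * (qq * eta)"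
      by (simp only: phi_Pp phi_Pm eta_eq) (simp add: algebra_simps)
    moreover have "vv * (2 * (Pp - Pm)) = qq - (vv * (Pp - 1)\<^sup>2 - vv * (Pm - 1)\<^sup>2)"
      by (simp add: qq_def power2_eq_square algebra_simps)
    ultimately show ?thesis by simp
  qed
  then have "qi * (vv * (2 * (Pp - Pm))) = qi * (qq - 2 * (qq * eta))" by (simp only:)
  also have "\<dots> = (qq * qi) * (1 - 2 * eta)" by (simp add: algebra_simps)
  finally have "qi * (vv * (2 * (Pp - Pm))) = (qq * qi) * (1 - 2 * eta)" .
  moreover have "qi * (vv * (2 * (Pp - Pm))) = 2 * ((vv * vi) * li * ((Pp - Pm) * ki))"
    by (simp only: qi_def ac_simps)
  ultimately show ?thesis by (simp add: qq_qi vv_vi ki)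
qed

text \<open>Here q \<rho> = v (P - M)^2 and q/\<rho> = v (P + M)^2, while 2 P and 2 M are the sum
  and the difference of P + M and P - M.\<close>

lemma sp_rr: "4 * sp = qq * (rr + 2 + ri)" and sm_rr: "4 * sm = qq * (rr - 2 + ri)"
proof -
  have *: "qq * rr = vv * (Pp - Pm)\<^sup>2" "qq * ri = vv * (Pp + Pm)\<^sup>2"
  proof -
    have "qq * rr = vv * (Pp - Pm)\<^sup>2 * ((Pp + Pm) * li)" "qq * ri = vv * (Pp + Pm)\<^sup>2 * ((Pp - Pm) * ki)"
      by (simp_all add: qq_def rr_def ri_def power2_eq_square algebra_simps)
    then show "qq * rr = vv * (Pp - Pm)\<^sup>2" "qq * ri = vv * (Pp + Pm)\<^sup>2" by (simp_all add: li ki)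
  qed
  show "4 * sp = qq * (rr + 2 + ri)" "4 * sm = qq * (rr - 2 + ri)"
    by (simp_all add: distrib_left right_diff_distrib *)
       (simp_all add: qq_def sp_def sm_def power2_eq_square algebra_simps)
qed

section \<open>Evaluation of the residue\<close>

text \<open>\<open>(Pp + Pm) / 2\<close> is the inverse of the divided difference \<open>\<Psi> = 1 - 2 * eta\<close>, by the lemma \<open>two_li\<close>.\<close>
definition Wser :: lser where "Wser = ap * am * (rat_ser (1/2) * (Pp + Pm))"

text \<open>Multiplying out the product in \<open>key_identity\<close> leaves 1, P, M and P M over P
  - M, and each of these is a simple expression in \<rho> and \<Psi>.\<close>

lemma form_expansion:
  "4 * (vv * yy\<^sup>2 * qi ^ N) = - (coords.W (1 - int N) 0 * ((ri - rr) * Wser - ap * (1 + ri) - am * (ri - 1) + (1 - 2 * eta) * ri) * om)"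
proof -
  have 1: "2 * (Pp * ki) = 1 + ri" "2 * (Pm * ki) = ri - 1"
    using ki by (simp_all add: ri_def algebra_simps)
  have 2: "2 * ki = (1 - 2 * eta) * ri"
  proof -
    have "(1 - 2 * eta) * ri = (2 * li) * ri" by (simp only: two_li)
    also have "\<dots> = 2 * ki * ((Pp + Pm) * li)" by (simp only: ri_def ac_simps)
    finally show ?thesis by (simp add: li)
  qed
  \<comment> \<open>This is 4 P M = (P + M)^2 - (P - M)^2.\<close>
  have 3: "2 * (Pp * Pm * ki) = (ri - rr) * (rat_ser (1/2) * (Pp + Pm))"
  proof -
    have "(ri - rr) * (Pp + Pm) = (Pp + Pm)\<^sup>2 * ki - (Pp - Pm) * ((Pp - Pm) * ki)"
    proof -
      have a: "(Pp - Pm) * ((Pp - Pm) * ki) = Pp - Pm" by (simp only: ki mult_1_right)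
      have b: "ri * (Pp + Pm) = (Pp + Pm)\<^sup>2 * ki" by (simp only: ri_def power2_eq_square ac_simps)
      show ?thesis unfolding left_diff_distrib[of ri rr] rr_mult a b ..
    qed
    also have "\<dots> = 2 * (2 * (Pp * Pm * ki))"
      by (simp add: power2_eq_square algebra_simps)
    finally have *: "(ri - rr) * (Pp + Pm) = \<dots>" .
    have "(ri - rr) * (rat_ser (1/2) * (Pp + Pm)) = rat_ser (1/2) * ((ri - rr) * (Pp + Pm))" by (simp only: ac_simps)
    then show ?thesis unfolding * rat_ser_half by simp
  qed
  have "2 * ((ap * Pp - 1) * (am * Pm - 1) * ki) = 
      ap * am * (2 * (Pp * Pm * ki)) - ap * (2 * (Pp * ki)) - am * (2 * (Pm * ki)) + 2 * ki"
    by (simp add: algebra_simps)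
  also have "\<dots> = (ri - rr) * Wser - ap * (1 + ri) - am * (ri - 1) + (1 - 2 * eta) * ri"
    unfolding 1 2 3 Wser_def by (simp only: ac_simps)
  finally have *: "2 * ((ap * Pp - 1) * (am * Pm - 1) * ki) = \<dots>" .
  have W: "coords.W (1 - int N) 0 = qq * qi ^ N"
    using coords.W_mult[of 1 0 "- int N" 0] by (simp add: coords.W_def)
  have "4 * (vv * yy\<^sup>2 * qi ^ N) = 2 * (2 * (vv * yy\<^sup>2)) * qi ^ N"
    by (simp add: ac_simps)
  also have "\<dots> = - (coords.W (1 - int N) 0 * (2 * ((ap * Pp - 1) * (am * Pm - 1) * ki)) * om)"
    unfolding key_identity W by (simp only: mult_minus_right mult_minus_left ac_simps)
  finally show ?thesis unfolding * .
qed

lemma nullord_power_sp_sm: "X \<in> coords.nullord n \<Longrightarrow> sp ^ l * X \<in> coords.nullord n"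
  "X \<in> coords.nullord n \<Longrightarrow> sm ^ l * X \<in> coords.nullord n"
  using coords.nullord_power_mult[of sp 2 X n l] coords.nullord_power_mult[of sm "-2" X n l] sp_rr sm_rr by simp_all

lemma nullord_Pser':
  assumes "X \<in> coords.nullord n"
  shows "Pser' sp * X \<in> coords.nullord n" "Pser' sm * X \<in> coords.nullord n"
proof -
  have "of_nat a * s * X \<in> coords.nullord n" if "s * X \<in> coords.nullord n" for s a
    using coords.nullord_of_int[OF that, of "int a"] by (simp add: mult.assoc)
  then have "Pser' sp * X \<in> coords.nullord (Suc n)" "Pser' sm * X \<in> coords.nullord (Suc n)"
    unfolding Pser'_def mps_csum_mult[symmetric]
    by (intro coords.nullord_csum; simp add: nullord_power_sp_sm assms)+
  then show "Pser' sp * X \<in> coords.nullord n" "Pser' sm * X \<in> coords.nullord n"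
    by (auto intro: coords.nullord_mono)
qed

lemma nullord_ap_am: "ap * am \<in> coords.nullord n"
proof -
  have two: "2 * X \<in> coords.nullord n" if "X \<in> coords.nullord n" for X
    using coords.nullord_of_int[OF that, of 2] by simp
  have "am = 1 - 2 * (Pser' sm * 1)" by (simp add: am_def)
  then have "am \<in> coords.nullord n"
    by (metis coords.nullord_diff coords.nullord_1 two nullord_Pser'(2))
  moreover have "ap * am = am - 2 * (Pser' sp * am)" by (simp add: ap_def algebra_simps)
  ultimately show ?thesis
    by (metis coords.nullord_diff two nullord_Pser'(1))
qed

text \<open>The inverse of \<Psi> enters only through the equation
  \<open>Wser = ap * am + 2 * (eta * Wser)\<close>; as \<open>eta\<close> raises the c-degree,
  induction on \<open>n\<close> applies.\<close>

lemma nullord_Wser: "Wser \<in> coords.nullord n"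
proof (induction n)
  case 0
  then show ?case by (simp add: coords.nullord_def)
next
  case (Suc n)
  have "Wser * (1 - 2 * eta) = Wser * (2 * li)" by (simp only: two_li)
  also have "\<dots> = ap * am * (rat_ser (1/2) * (2 * ((Pp + Pm) * li)))" by (simp only: Wser_def ac_simps)
  also have "\<dots> = ap * am" by (subst rat_ser_half) (simp add: li)
  finally have "Wser * (1 - 2 * eta) = ap * am" .
  then have *: "Wser = ap * am + 2 * (eta * Wser)" by (simp add: algebra_simps)
  have "eta * Wser \<in> coords.nullord (Suc n)"
    unfolding eta_def mps_csum_mult[symmetric] sum_distrib_right
    by (intro coords.nullord_csum coords.nullord_sum) (simp add: mult.assoc nullord_power_sp_sm Suc)
  from coords.nullord_of_int[OF this, of 2] have "2 * (eta * Wser) \<in> coords.nullord (Suc n)" by simp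
  then show ?case by (subst *) (intro coords.nullord_add nullord_ap_am)
qed

section \<open>The terms linear in the c_a\<close>

text \<open>The factor of 2 c_c in the bracket of \<open>form_expansion\<close>. It depends on the
  c_a only through s, t and \<rho>, hence not at all when expressed in q and \<rho>.\<close>

definition lin_coeff :: "nat \<Rightarrow> lser" where
  "lin_coeff c = of_nat c * sp ^ (c - 1) * (1 + ri) + of_nat c * sm ^ (c - 1) * (ri - 1)
      - (\<Sum>i<c. sm ^ (c - Suc i) * sp ^ i) * ri"

lemma linear_part: "- ap * (1 + ri) - am * (ri - 1) + (1 - 2 * eta) * ri = 2 * mps_csum lin_coeff - ri"
proof -
  have "mps_csum lin_coeff = Pser' sp * (1 + ri) + Pser' sm * (ri - 1) - eta * ri"
    by (simp only: lin_coeff_def[abs_def] mps_csum_add mps_csum_diff mps_csum_mult Pser'_def eta_def)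
  then show ?thesis by (simp only:) (simp add: ap_def am_def algebra_simps)
qed

text \<open>In the coordinates, 4 s = q (1 + \<rho>)^2/\<rho> and 4 t = q (1 - \<rho>)^2/\<rho>, so
  every term is q^(c - N) times a power of 1 + \<rho> or 1 - \<rho> over a power of \<rho>. The
  exponent of q forces c = N, and \<open>CT_binomial\<close> reads off the rest.\<close>

lemma CT_lin_coeff:
  assumes "N > 0" "even N"
  shows "4 ^ N * CT (coords.W (1 - int N) 0 * lin_coeff c * om) m = (if c = N \<and> m = 0 then 
     2 * (4 * of_nat N * of_nat ((2 * N - 1) choose N) - of_nat ((2 * N) choose (N + 1))) else 0)"
proof (cases c)
  case 0
  then show ?thesis using assms by (simp add: lin_coeff_def)
next
  case (Suc d)
  define U where "U \<sigma> k n = (1 + of_int \<sigma> * rr) ^ k * ri ^ n" for \<sigma> k n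
  have s4: "4 * sp = coords.W 1 0 * U 1 2 1" "4 * sm = coords.W 1 0 * U (-1) 2 1"
  proof -
    have "rr + 2 + ri = U 1 2 1" "rr - 2 + ri = U (-1) 2 1"
      using rr_ri by (simp_all add: U_def power2_eq_square algebra_simps flip: mult.assoc)
    then show "4 * sp = coords.W 1 0 * U 1 2 1" "4 * sm = coords.W 1 0 * U (-1) 2 1"
      by (simp_all add: sp_rr sm_rr coords.W_def)
  qed
  have s4p: "4 ^ k * sp ^ k = coords.W (int k) 0 * U 1 (2 * k) k" "4 ^ k * sm ^ k = coords.W (int k) 0 * U (-1) (2 * k) k" for k
    using arg_cong[OF s4(1), of "\<lambda>x. x ^ k"] arg_cong[OF s4(2), of "\<lambda>x. x ^ k"]
    by (simp_all add: power_mult_distrib coords.W_power U_def flip: power_mult)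
  have r1: "1 + ri = U 1 1 1" "ri - 1 = U (-1) 1 1"
    using rr_ri by (simp_all add: U_def algebra_simps)
  have Um: "U \<sigma> k n * U \<sigma> k' n' = U \<sigma> (k + k') (n + n')" for \<sigma> k n k' n'
    by (simp add: U_def power_add ac_simps)
  have Ur: "U \<sigma> k n * ri = U \<sigma> k (Suc n)" for \<sigma> k n
    by (simp add: U_def ac_simps)
  have Wc: "coords.W (1 - int N) 0 * coords.W (int d) 0 = coords.W (int c - int N) 0"
  proof -
    have "1 - int N + int d = int c - int N" by (simp add: Suc)
    then show ?thesis unfolding coords.W_mult by (simp only: add_0)
  qed
  \<comment> \<open>One factor q = s - t turns the divided difference back into s^c - t^c.\<close>
  have e: "coords.W (1 - int N) 0 * (\<Sum>i<c. sm ^ (c - Suc i) * sp ^ i) = coords.W (- int N) 0 * (sp ^ c - sm ^ c)"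
  proof -
    have "coords.W (1 - int N) 0 = coords.W (- int N) 0 * coords.W 1 0"
      using coords.W_mult[of "- int N" 0 1 0] by simp
    moreover have "coords.W 1 0 = sp - sm" using coords.q_eq_W qq_eq by (rule subst)
    ultimately show ?thesis by (simp add: power_diff_sumr2 mult.assoc)
  qed
  have "4 ^ c * (coords.W (1 - int N) 0 * lin_coeff c * om)
    = of_int (4 * int c) * (coords.W (1 - int N) 0 * ((4 ^ d * sp ^ d) * (1 + ri)) * om)
      + of_int (4 * int c) * (coords.W (1 - int N) 0 * ((4 ^ d * sm ^ d) * (ri - 1)) * om)
      - 4 ^ c * (coords.W (1 - int N) 0 * (\<Sum>i<c. sm ^ (c - Suc i) * sp ^ i)) * ri * om"
    by (simp add: lin_coeff_def Suc algebra_simps)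
  also have "4 ^ c * (coords.W (1 - int N) 0 * (\<Sum>i<c. sm ^ (c - Suc i) * sp ^ i)) * ri * om
    = coords.W (- int N) 0 * ((4 ^ c * sp ^ c) * ri) * om - coords.W (- int N) 0 * ((4 ^ c * sm ^ c) * ri) * om"
    unfolding e by (simp add: algebra_simps)
  also have "coords.W (- int N) 0 * ((4 ^ c * sp ^ c) * ri) = coords.W (int c - int N) 0 * U 1 (2 * c) (Suc c)"
    unfolding s4p mult.assoc Ur by (simp add: coords.W_mult flip: mult.assoc)
  also have "coords.W (- int N) 0 * ((4 ^ c * sm ^ c) * ri) = coords.W (int c - int N) 0 * U (-1) (2 * c) (Suc c)"
    unfolding s4p mult.assoc Ur by (simp add: coords.W_mult flip: mult.assoc)
  also have "coords.W (1 - int N) 0 * ((4 ^ d * sp ^ d) * (1 + ri)) = coords.W (int c - int N) 0 * U 1 (2 * c - 1) c"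
    unfolding s4p mult.assoc r1 Um by (simp add: Wc Suc flip: mult.assoc)
  also have "coords.W (1 - int N) 0 * ((4 ^ d * sm ^ d) * (ri - 1)) = coords.W (int c - int N) 0 * U (-1) (2 * c - 1) c"
    unfolding s4p mult.assoc r1 Um by (simp add: Wc Suc flip: mult.assoc)
  finally have *: "4 ^ c * (coords.W (1 - int N) 0 * lin_coeff c * om) = 
     of_int (4 * int c) * (coords.W (int c - int N) 0 * U 1 (2 * c - 1) c * om) +
     of_int (4 * int c) * (coords.W (int c - int N) 0 * U (- 1) (2 * c - 1) c * om) -
     (coords.W (int c - int N) 0 * U 1 (2 * c) (Suc c) * om - coords.W (int c - int N) 0 * U (- 1) (2 * c) (Suc c) * om)" .
  have "4 ^ c * CT (coords.W (1 - int N) 0 * lin_coeff c * om) m = CT (of_int (4 ^ c) * (coords.W (1 - int N) 0 * lin_coeff c * om)) m"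
    by (simp only: CT_of_int_mult) simp
  also have "\<dots> = CT (4 ^ c * (coords.W (1 - int N) 0 * lin_coeff c * om)) m" by simp
  also have "\<dots> = of_int (4 * int c) * CT (coords.W (int c - int N) 0 * U 1 (2 * c - 1) c * om) m +
     of_int (4 * int c) * CT (coords.W (int c - int N) 0 * U (- 1) (2 * c - 1) c * om) m -
     (CT (coords.W (int c - int N) 0 * U 1 (2 * c) (Suc c) * om) m - CT (coords.W (int c - int N) 0 * U (- 1) (2 * c) (Suc c) * om) m)"
    unfolding * by (simp only: CT_add CT_diff CT_of_int_mult)
  finally have ct: "4 ^ c * CT (coords.W (1 - int N) 0 * lin_coeff c * om) m = \<dots>" .
  show ?thesis
  proof (cases "c = N \<and> m = 0")
    case True
    \<comment> \<open>For even \<open>N\<close> the contributions of s and t have matching signs,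
      whence the factor 2.\<close>
    then show ?thesis using ct assms(2) unfolding U_def coords.CT_binomial by (simp add: algebra_simps)
  next
    case False
    then have "4 ^ c * CT (coords.W (1 - int N) 0 * lin_coeff c * om) m = 0" using ct unfolding U_def coords.CT_binomial by auto
    then show ?thesis unfolding if_not_P[OF False] by simp
  qed
qed

lemma CT_form:
  assumes "N > 0" "even N"
  shows "4 ^ N * CT (vv * yy\<^sup>2 * qi ^ N) m = (if m = Poly_Mapping.single N 1
    then - (4 * of_nat N * of_nat ((2 * N - 1) choose N) - of_nat ((2 * N) choose (N + 1))) else 0)"
proof -
  define g :: rat where "g = 4 * of_nat N * of_nat ((2 * N - 1) choose N) - of_nat ((2 * N) choose (N + 1))"
  have G: "4 ^ N * CT (coords.W (1 - int N) 0 * lin_coeff c * om) k = (if c = N \<and> k = 0 then 2 * g else 0)" for c k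
    using CT_lin_coeff[OF assms, of c k] by (simp add: g_def)
  \<comment> \<open>The anti-invariant term: 1/\<rho> - \<rho> against the invariant
    \<open>Wser\<close>.\<close>
  have 1: "CT (coords.W (1 - int N) 0 * ((ri - rr) * Wser) * om) m = 0"
  proof -
    have "CT (Wser * ((coords.W (1 - int N) (-1) - coords.W (1 - int N) (- (-1))) * om)) m = 0"
      using nullord_Wser[of "Suc (mdeg m)"] unfolding coords.nullord_def by blast
    also have "coords.W (1 - int N) (-1) - coords.W (1 - int N) (- (-1)) = coords.W (1 - int N) 0 * (ri - rr)"
      by (simp add: coords.W_def algebra_simps)
    finally show ?thesis by (simp add: ac_simps)
  qed
  have 2: "CT (coords.W (1 - int N) 0 * ri * om) m = 0"
  proof -
    have "coords.W (1 - int N) 0 * ri = coords.W (1 - int N) (-1)" by (simp add: coords.W_def)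
    then show ?thesis by (simp add: coords.CT_W_omega)
  qed
  have 3: "4 ^ N * CT (coords.W (1 - int N) 0 * mps_csum lin_coeff * om) m = (if m = Poly_Mapping.single N 1 then 2 * g else 0)"
  proof -
    have "coords.W (1 - int N) 0 * mps_csum lin_coeff * om = mps_csum (\<lambda>c. coords.W (1 - int N) 0 * lin_coeff c * om)"
      by (simp only: mps_csum_mult mps_csum_mult_left)
    then have "4 ^ N * CT (coords.W (1 - int N) 0 * mps_csum lin_coeff * om) m =
       (\<Sum>a\<in>Poly_Mapping.keys m. if a = N \<and> m - Poly_Mapping.single a 1 = 0 then 2 * g else 0)"
      by (simp add: CT_csum sum_distrib_left G)
    \<comment> \<open>Removing \<open>c_a\<close> from \<open>m\<close> must leave the monomial 1,
      so \<open>m\<close> is \<open>c_a\<close> itself.\<close>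
    also have "\<dots> = (\<Sum>a\<in>Poly_Mapping.keys m. if a = N then (if m = Poly_Mapping.single N 1 then 2 * g else 0) else 0)"
    proof (rule sum.cong[OF refl])
      fix a assume "a \<in> Poly_Mapping.keys m"
      then have "Poly_Mapping.single a 1 + (m - Poly_Mapping.single a 1) = m" by (rule mdeg_diff_single(1))
      then have "m - Poly_Mapping.single a 1 = 0 \<longleftrightarrow> m = Poly_Mapping.single a 1"
        by (metis add.right_neutral add_left_cancel)
      then show "(if a = N \<and> m - Poly_Mapping.single a 1 = 0 then 2 * g else 0)
        = (if a = N then (if m = Poly_Mapping.single N 1 then 2 * g else 0) else 0)" by auto
    qed
    also have "\<dots> = (if m = Poly_Mapping.single N 1 then 2 * g else 0)"
      by auto
    finally show ?thesis .
  qed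
  have "4 * (vv * yy\<^sup>2 * qi ^ N) = coords.W (1 - int N) 0 * ri * om - coords.W (1 - int N) 0 * ((ri - rr) * Wser) * om
      - 2 * (coords.W (1 - int N) 0 * mps_csum lin_coeff * om)"
  proof -
    have "(ri - rr) * Wser - ap * (1 + ri) - am * (ri - 1) + (1 - 2 * eta) * ri = (ri - rr) * Wser + (2 * mps_csum lin_coeff - ri)"
      unfolding linear_part[symmetric] by simp
    then show ?thesis unfolding form_expansion by (simp only:) (simp add: algebra_simps)
  qed
  from arg_cong[OF this, of "\<lambda>f. CT f m"]
  have "4 * CT (vv * yy\<^sup>2 * qi ^ N) m = - 2 * CT (coords.W (1 - int N) 0 * mps_csum lin_coeff * om) m"
    using CT_of_int_mult[of 4 "vv * yy\<^sup>2 * qi ^ N" m] CT_of_int_mult[of 2 "coords.W (1 - int N) 0 * mps_csum lin_coeff * om" m]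
    by (simp add: CT_diff 1 2)
  then have "4 * (4 ^ N * CT (vv * yy\<^sup>2 * qi ^ N) m) = - 2 * (4 ^ N * CT (coords.W (1 - int N) 0 * mps_csum lin_coeff * om) m)"
    by (simp only: mult.left_commute[of 4]) 
  then show ?thesis unfolding 3 by (auto simp: g_def)
qed

section \<open>The given negative power and the final coefficient\<close>

text \<open>Both sides are inverse to the N-th power of S: the left one by the binomial series, the
  right one because q = 4 v S.\<close>

lemma Sinvpow_eq: "Abs_mps (Sinvpow N) = 4 ^ N * (vv ^ N * qi ^ N)"
proof -
  define S where "S = Abs_mps Sser"
  define f where "f = Abs_mps epsser"
  have f: "f = yi * S - 1"
    by (simp add: f_def epsser_def Abs_mps_ssub Abs_mps_smul Abs_mps_sconst S_def cmon_def)
  have qS: "qq = 4 * vv * S" unfolding qq_def Sser_eq[symmetric] S_def by (simp only: ac_simps)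
  have f1: "f \<in> mps_ord 1"
  proof (rule mps_ord_1I)
    \<comment> \<open>At c = 0, q = 4 v y gives S = y, so eps has no constant term and may be
      substituted into the binomial series.\<close>
    have "4 * (mon 1 0 * mps_nth S 0) = mps_nth qq 0"
      by (simp add: qS mult.assoc) (simp add: cmon_def)
    then have "2 * (2 * (mon 1 0 * mps_nth S 0)) = 2 * (2 * mon 1 1)" by (simp add: nth_0_qq)
    then have "mon 1 0 * mps_nth S 0 = mon 1 1" by (metis lconst_half)
    then have "mon (-1) 0 * mon 1 0 * mps_nth S 0 = mon (-1) 0 * mon 1 1" by (simp add: mult.assoc)
    then have "mps_nth (yi * S) 0 = 1"
      by (simp add: mon_mult mon_0_0 cmon_def)
    then show "mps_nth f 0 = 0" by (simp add: f mps_nth_1)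
  qed
  define Z where "Z = mps_eval (\<lambda>k. lconst ((- of_nat N :: rat) gchoose k)) f"
  have Z: "Z * (yi * S) ^ N = 1"
    using mps_eval_gbinomial[OF f1, of lconst N] additive_lconst 
    by (simp add: Z_def f lconst_def flip: zero_prod_def)
  have X: "Abs_mps (Sinvpow N) = cmon 0 (- int N) * Z"
  proof -
    have "Abs_mps (ssum (\<lambda>k. sscale (lconst ((- of_nat N :: rat) gchoose k)) (spow epsser k))) = Z"
    proof (rule mps_eqI)
      fix m
      let ?F = "\<lambda>k. lconst ((- of_nat N :: rat) gchoose k) * mps_nth (f ^ k) m"
      have F: "sscale (lconst ((- of_nat N :: rat) gchoose k)) (spow epsser k) m = ?F k" for k
        by (simp add: sscale_def f_def flip: Abs_mps_spow)
      have "mps_nth (f ^ k) m = 0" if "k > mdeg m" for k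
        using mps_ordD[OF mps_ord_power[OF f1], of m k] that by simp
      then have "(\<Sum>k\<in>{k. ?F k \<noteq> 0}. ?F k) = (\<Sum>k\<le>mdeg m. ?F k)"
        by (intro sum.mono_neutral_left) (auto simp: not_less[symmetric])
      then show "mps_nth (Abs_mps (ssum (\<lambda>k. sscale (lconst ((- of_nat N :: rat) gchoose k)) (spow epsser k)))) m = mps_nth Z m"
        by (simp add: ssum_def F Z_def mps_eval_def)
    qed
    then show ?thesis by (simp add: Sinvpow_def Abs_mps_sscale cmon_def)
  qed
  have "cmon 0 (- int N) * Z * S ^ N = Z * (yi * S) ^ N"
    by (simp add: power_mult_distrib cmon_power ac_simps)
  then have XS: "cmon 0 (- int N) * Z * S ^ N = 1" by (simp only: Z)
  have "4 ^ N * (vv ^ N * qi ^ N) = (cmon 0 (- int N) * Z * S ^ N) * (4 ^ N * (vv ^ N * qi ^ N))"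
    by (simp only: XS mult_1_left)
  also have "\<dots> = cmon 0 (- int N) * Z * (4 * vv * S * qi) ^ N"
    by (simp only: power_mult_distrib ac_simps)
  also have "4 * vv * S * qi = 1" by (simp only: qS[symmetric] qq_qi)
  finally show ?thesis by (simp add: X)
qed

lemma binomial_identity:
  assumes "N > 0"
  shows "4 * of_nat N * of_nat ((2 * N - 1) choose N) - of_nat ((2 * N) choose (N + 1))
    = (fact (2 * N + 1) / (fact (N - 1) * fact (N + 1)) :: rat)"
proof -
  obtain n where N: "N = Suc n" using assms gr0_conv_Suc by blast
  have 1: "of_nat ((2 * N - 1) choose N) = (fact (2 * n + 1) / (fact (n + 1) * fact n) :: rat)"
    using binomial_fact[of N "2 * N - 1", where 'a = rat] by (simp add: N)
  have 2: "of_nat ((2 * N) choose (N + 1)) = (fact (2 * n + 2) / (fact (n + 2) * fact n) :: rat)"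
    using binomial_fact[of "N + 1" "2 * N", where 'a = rat] by (simp add: N)
  \<comment> \<open>With N = n + 1 all factorials become rational multiples of (2n+1)! and n!, and
    an identity of rational functions in n remains.\<close>
  define F f :: rat where "F = fact (2 * n + 1)" and "f = fact n"
  have "f \<noteq> 0" by (simp add: f_def)
  have F: "fact (2 * n + 2) = (2 * of_nat n + 2) * F" "fact (2 * n + 3) = (2 * of_nat n + 3) * ((2 * of_nat n + 2) * F)"
    by (simp_all add: F_def fact_reduce[of "2 * n + 2"] fact_reduce[of "2 * n + 3"] numeral_3_eq_3 algebra_simps)
  have f: "fact (n + 1) = (of_nat n + 1) * f" "fact (n + 2) = (of_nat n + 2) * ((of_nat n + 1) * f)"
    by (simp_all add: f_def algebra_simps)
  have n: "of_nat n + 1 \<noteq> (0::rat)" "of_nat n + 2 \<noteq> (0::rat)" by (metis of_nat_0_le_iff add_nonneg_pos less_numeral_extra(1,3) zero_less_numeral)+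
  have "4 * (of_nat n + 1) * (F / (((of_nat n + 1) * f) * f)) - ((2 * of_nat n + 2) * F) / ((of_nat n + 2) * ((of_nat n + 1) * f) * f)
     = (2 * of_nat n + 3) * ((2 * of_nat n + 2) * F) / (f * ((of_nat n + 2) * ((of_nat n + 1) * f)))"
    using n \<open>f \<noteq> 0\<close> by (simp add: divide_simps) (simp add: algebra_simps)
  moreover have "2 * N + 1 = 2 * n + 3" "N - 1 = n" "N + 1 = n + 2" by (simp_all add: N)
  ultimately show ?thesis
    unfolding 1 2 by (simp only: F f F_def[symmetric] f_def[symmetric]) (simp add: N add.commute)
qed

theorem theorem1:
  fixes N :: nat
  assumes "N > 0" and "even N"
  shows "(\<lambda>m. Poly_Mapping.lookup (Sinvpow N m) (int N - 1, -2))
       = (\<lambda>m. if m = Poly_Mapping.single N 1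
               then - (fact (2 * N + 1) / (fact (N - 1) * fact (N + 1)) :: rat)
               else 0)"
proof
  fix m
  \<comment> \<open>Multiplication by v^(1-N) y^2 moves the wanted coefficient to the constant term;
    with the v^N from \<open>Sinvpow_eq\<close> this leaves v y^2.\<close>
  have "Poly_Mapping.lookup (Sinvpow N m) (int N - 1, -2) = CT (cmon (1 - int N) 2 * Abs_mps (Sinvpow N)) m"
    by (simp add: CT_cmon_mult)
  also have "cmon (1 - int N) 2 * Abs_mps (Sinvpow N) = of_int (4 ^ N) * ((cmon (1 - int N) 2 * vv ^ N) * qi ^ N)"
    unfolding Sinvpow_eq by (simp add: ac_simps)
  also have "cmon (1 - int N) 2 * vv ^ N = vv * yy\<^sup>2"
    by (simp add: cmon_power cmon_mult)
  also have "CT (of_int (4 ^ N) * (vv * yy\<^sup>2 * qi ^ N)) m = 4 ^ N * CT (vv * yy\<^sup>2 * qi ^ N) m"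
    by (simp only: CT_of_int_mult) simp
  finally show "Poly_Mapping.lookup (Sinvpow N m) (int N - 1, -2) = (if m = Poly_Mapping.single N 1
               then - (fact (2 * N + 1) / (fact (N - 1) * fact (N + 1)) :: rat) else 0)"
    unfolding CT_form[OF assms] binomial_identity[OF assms(1)] .
qed

end
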